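(* Let $(N,\xi)$ be a closed connected co-oriented contact manifold, and let $\alpha$ and $\alpha'=f\cdot\alpha$, with $f\in C^\infty(N,\mathbb{R}_{>0})$, be two global contact forms for $\xi$ compatible with its co-orientation. Then $$\min_N(f)\cdot d_\alpha\le d_{\alpha'}\le\max_N(f)\cdot d_\alpha$$ on $\mathcal{G}=\mathrm{Cont}_0(N,\xi)$, and therefore the metrics $d_\alpha$ and $d_{\alpha'}$ are equivalent.
   Context: $\mathcal{G}=\mathrm{Cont}_0(N,\xi)$ is the group of diffeomorphisms of $N$ preserving $\xi$ and its co-orientation that are isotopic to the identity through such diffeomorphisms. For a contact form $\alpha$ and a smooth isotopy $\{\psi_t\}_{t\in[0,1]}$ in $\mathcal{G}$, $\psi_0=1$, generated by $Y_t$ (i.e. $\frac{d}{dt}\psi_t=Y_t\circ\psi_t$), the contact Hamiltonian is $H_t=\alpha(Y_t)$. Define $|\psi|_\alpha=\inf\int_0^1\max_N|H_t|\,dt$ over all such isotopies with $\psi_1=\psi$, and $d_\alpha(\phi,\psi)=|\psi\phi^{-1}|_\alpha$ for $\phi,\psi\in\mathcal{G}$. *)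

theory Defs
  imports "HOL-Analysis.Analysis"
begin

section \<open>Smooth maps between Euclidean spaces\<close>

text \<open>The predicate \<open>Ck_on k S f\<close> is meant for open sets \<open>S\<close>. Since the directions range over a
  finite-dimensional space in all uses below, it says that \<open>f\<close> is \<open>k\<close> times continuously
  differentiable on \<open>S\<close>.\<close>

primrec Ck_on :: "nat \<Rightarrow> 'e::real_normed_vector set \<Rightarrow> ('e \<Rightarrow> 'f::real_normed_vector) \<Rightarrow> bool" where
  "Ck_on 0 S f \<longleftrightarrow> continuous_on S f"
| "Ck_on (Suc k) S f \<longleftrightarrow>
     (\<forall>x\<in>S. f differentiable (at x)) \<and>
     (\<forall>v. Ck_on k S (\<lambda>x. frechet_derivative f (at x) v))"

text \<open>On an arbitrary set, smoothness means local extendability to a smooth map on an open set. On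
  open sets this is the usual notion; the general case is needed for the closed time interval.\<close>

definition smooth_on :: "'e::real_normed_vector set \<Rightarrow> ('e \<Rightarrow> 'f::real_normed_vector) \<Rightarrow> bool" where
  "smooth_on S f \<longleftrightarrow>
     (\<forall>x\<in>S. \<exists>W g. open W \<and> x \<in> W \<and> (\<forall>k. Ck_on k W g) \<and> (\<forall>y\<in>S \<inter> W. g y = f y))"

section \<open>Smooth manifolds\<close>

text \<open>The underlying space of the manifold is a whole (Hausdorff, second countable) type \<open>'a\<close>;
  charts take values in a Euclidean space \<open>'e\<close>. All notions refer to an atlas, which need not be
  maximal.\<close>

datatype ('a, 'e) chart = Chart (dom: "'a set") (coord: "'a \<Rightarrow> 'e")

definition param :: "('a, 'e) chart \<Rightarrow> 'e \<Rightarrow> 'a" where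
  "param c = inv_into (dom c) (coord c)"

definition smooth_atlas ::
  "('a::{t2_space,second_countable_topology}, 'e::euclidean_space) chart set \<Rightarrow> bool" where
  "smooth_atlas A \<longleftrightarrow>
     (\<Union>c\<in>A. dom c) = UNIV \<and>
     (\<forall>c\<in>A. open (dom c) \<and> open (coord c ` dom c) \<and>
        homeomorphism (dom c) (coord c ` dom c) (coord c) (param c)) \<and>
     (\<forall>c\<in>A. \<forall>d\<in>A. smooth_on (coord c ` (dom c \<inter> dom d)) (coord d \<circ> param c))"

definition chart_at :: "('a, 'e) chart set \<Rightarrow> 'a \<Rightarrow> ('a, 'e) chart" where
  "chart_at A p = (SOME c. c \<in> A \<and> p \<in> dom c)"

definition smooth_function ::
  "('a, 'e::euclidean_space) chart set \<Rightarrow> ('a \<Rightarrow> real) \<Rightarrow> bool" where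
  "smooth_function A f \<longleftrightarrow> (\<forall>c\<in>A. smooth_on (coord c ` dom c) (f \<circ> param c))"

definition smooth_map ::
  "('a::topological_space, 'e::euclidean_space) chart set \<Rightarrow> ('a \<Rightarrow> 'a) \<Rightarrow> bool" where
  "smooth_map A F \<longleftrightarrow>
     continuous_on UNIV F \<and>
     (\<forall>c\<in>A. \<forall>d\<in>A. smooth_on (coord c ` {x \<in> dom c. F x \<in> dom d}) (coord d \<circ> F \<circ> param c))"

definition diffeomorphism ::
  "('a::topological_space, 'e::euclidean_space) chart set \<Rightarrow> ('a \<Rightarrow> 'a) \<Rightarrow> bool" where
  "diffeomorphism A F \<longleftrightarrow> bij F \<and> smooth_map A F \<and> smooth_map A (inv F)"

section \<open>Tangent vectors\<close>

text \<open>A tangent vector at \<open>p\<close> is the family of its coordinate vectors with respect to the charts of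
  the atlas around \<open>p\<close>, related by the derivatives of the transition maps. The components at all
  other charts are set to zero, so that a tangent vector is determined by its coordinates.\<close>

type_synonym ('a, 'e) tvec = "('a, 'e) chart \<Rightarrow> 'e"

definition tangent_space ::
  "('a, 'e::euclidean_space) chart set \<Rightarrow> 'a \<Rightarrow> ('a, 'e) tvec set" where
  "tangent_space A p =
     {v. (\<forall>c\<in>A. \<forall>d\<in>A. p \<in> dom c \<inter> dom d \<longrightarrow>
            v d = frechet_derivative (coord d \<circ> param c) (at (coord c p)) (v c)) \<and>
         (\<forall>c. c \<notin> A \<or> p \<notin> dom c \<longrightarrow> v c = 0)}"

text \<open>The tangent vector at \<open>p\<close> whose coordinates in the chart \<open>c\<close> are \<open>w\<close>.\<close>

definition coord_vec ::
  "('a, 'e::euclidean_space) chart set \<Rightarrow> ('a, 'e) chart \<Rightarrow> 'a \<Rightarrow> 'e \<Rightarrow> ('a, 'e) tvec" where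
  "coord_vec A c p w =
     (\<lambda>d. if d \<in> A \<and> p \<in> dom d
          then frechet_derivative (coord d \<circ> param c) (at (coord c p)) w else 0)"

definition tangent_map ::
  "('a, 'e::euclidean_space) chart set \<Rightarrow> ('a \<Rightarrow> 'a) \<Rightarrow> 'a \<Rightarrow> ('a, 'e) tvec \<Rightarrow> ('a, 'e) tvec" where
  "tangent_map A F p v =
     (let c = chart_at A p in
      (\<lambda>d. if d \<in> A \<and> F p \<in> dom d
           then frechet_derivative (coord d \<circ> F \<circ> param c) (at (coord c p)) (v c) else 0))"

text \<open>The velocity at time \<open>t\<close> of a curve defined on \<open>[0,1]\<close> (one-sided at the end points).\<close>

definition velocity ::
  "('a, 'e::euclidean_space) chart set \<Rightarrow> (real \<Rightarrow> 'a) \<Rightarrow> real \<Rightarrow> ('a, 'e) tvec" where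
  "velocity A \<gamma> t =
     (\<lambda>d. if d \<in> A \<and> \<gamma> t \<in> dom d
          then vector_derivative (\<lambda>s. coord d (\<gamma> s)) (at t within {0..1}) else 0)"

section \<open>One-forms\<close>

text \<open>Only the values of a one-form on tangent vectors are relevant.\<close>

type_synonym ('a, 'e) form1 = "'a \<Rightarrow> ('a, 'e) tvec \<Rightarrow> real"

text \<open>The local expression of a one-form in the chart \<open>c\<close>, evaluated at the coordinate point \<open>y\<close> on
  the constant coordinate vector field \<open>w\<close>.\<close>

definition local_form ::
  "('a, 'e::euclidean_space) chart set \<Rightarrow> ('a, 'e) form1 \<Rightarrow> ('a, 'e) chart \<Rightarrow> 'e \<Rightarrow> 'e \<Rightarrow> real" where
  "local_form A \<alpha> c y w = \<alpha> (param c y) (coord_vec A c (param c y) w)"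

definition smooth_one_form_on ::
  "('a, 'e::euclidean_space) chart set \<Rightarrow> 'a set \<Rightarrow> ('a, 'e) form1 \<Rightarrow> bool" where
  "smooth_one_form_on A U \<alpha> \<longleftrightarrow>
     (\<forall>p\<in>U. \<forall>v\<in>tangent_space A p. \<forall>w\<in>tangent_space A p. \<forall>a b.
        \<alpha> p (\<lambda>c. a *\<^sub>R v c + b *\<^sub>R w c) = a * \<alpha> p v + b * \<alpha> p w) \<and>
     (\<forall>c\<in>A. \<forall>w. smooth_on (coord c ` (dom c \<inter> U)) (\<lambda>y. local_form A \<alpha> c y w))"

text \<open>The exterior derivative: in coordinates, the formula
  \<open>d\<alpha>(V,W) = V(\<alpha>(W)) - W(\<alpha>(V)) - \<alpha>([V,W])\<close> for constant vector fields, whose bracket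
  vanishes. The result does not depend on the chart.\<close>

definition ext_deriv ::
  "('a, 'e::euclidean_space) chart set \<Rightarrow> ('a, 'e) form1 \<Rightarrow>
     'a \<Rightarrow> ('a, 'e) tvec \<Rightarrow> ('a, 'e) tvec \<Rightarrow> real" where
  "ext_deriv A \<alpha> p v w =
     (let c = chart_at A p in
        frechet_derivative (\<lambda>y. local_form A \<alpha> c y (w c)) (at (coord c p)) (v c)
      - frechet_derivative (\<lambda>y. local_form A \<alpha> c y (v c)) (at (coord c p)) (w c))"

section \<open>Co-oriented contact manifolds\<close>

text \<open>A plane field \<open>\<xi>\<close> assigns to each point a set of tangent vectors. A co-orientation of a
  hyperplane field is an orientation of the line bundle \<open>TN/\<xi>\<close>; it is given by the set \<open>pos p\<close> of
  those vectors at \<open>p\<close> that are positively transverse to \<open>\<xi>\<close>. The predicate below says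
  that \<open>\<alpha>\<close> is a contact form on the open set \<open>U\<close> that defines \<open>\<xi>\<close> and is compatible with the
  co-orientation; maximal non-integrability is the last clause (\<open>d\<alpha>\<close> is non-degenerate on \<open>\<xi>\<close>).\<close>

definition contact_form_on ::
  "('a, 'e::euclidean_space) chart set \<Rightarrow> ('a \<Rightarrow> ('a, 'e) tvec set) \<Rightarrow> ('a \<Rightarrow> ('a, 'e) tvec set) \<Rightarrow>
     'a set \<Rightarrow> ('a, 'e) form1 \<Rightarrow> bool" where
  "contact_form_on A \<xi> pos U \<alpha> \<longleftrightarrow>
     smooth_one_form_on A U \<alpha> \<and>
     (\<forall>p\<in>U. (\<exists>v\<in>tangent_space A p. \<alpha> p v \<noteq> 0) \<and>
        \<xi> p = {v \<in> tangent_space A p. \<alpha> p v = 0} \<and>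
        pos p = {v \<in> tangent_space A p. \<alpha> p v > 0} \<and>
        (\<forall>v\<in>\<xi> p. (\<forall>w\<in>\<xi> p. ext_deriv A \<alpha> p v w = 0) \<longrightarrow> v = (\<lambda>_. 0)))"

text \<open>Non-degeneracy forces \<open>\<xi>\<close> to have even rank, so the manifold has odd dimension.\<close>

definition cooriented_contact_structure ::
  "('a::topological_space, 'e::euclidean_space) chart set \<Rightarrow>
     ('a \<Rightarrow> ('a, 'e) tvec set) \<Rightarrow> ('a \<Rightarrow> ('a, 'e) tvec set) \<Rightarrow> bool" where
  "cooriented_contact_structure A \<xi> pos \<longleftrightarrow>
     (\<forall>p. \<exists>U \<beta>. open U \<and> p \<in> U \<and> contact_form_on A \<xi> pos U \<beta>)"

section \<open>Contactomorphisms and isotopies\<close>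

definition Cont ::
  "('a::topological_space, 'e::euclidean_space) chart set \<Rightarrow>
     ('a \<Rightarrow> ('a, 'e) tvec set) \<Rightarrow> ('a \<Rightarrow> ('a, 'e) tvec set) \<Rightarrow> ('a \<Rightarrow> 'a) set" where
  "Cont A \<xi> pos =
     {F. diffeomorphism A F \<and>
         (\<forall>p. tangent_map A F p ` \<xi> p = \<xi> (F p) \<and> tangent_map A F p ` pos p = pos (F p))}"

text \<open>Joint smoothness of \<open>(t, x) \<mapsto> \<psi> t x\<close> on \<open>[0,1] \<times> N\<close>.\<close>

definition smooth_family ::
  "('a::topological_space, 'e::euclidean_space) chart set \<Rightarrow> (real \<Rightarrow> 'a \<Rightarrow> 'a) \<Rightarrow> bool" where
  "smooth_family A \<psi> \<longleftrightarrow>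
     continuous_on ({0..1} \<times> UNIV) (\<lambda>(t, x). \<psi> t x) \<and>
     (\<forall>c\<in>A. \<forall>d\<in>A.
        smooth_on {(t, coord c x) | t x. t \<in> {0..1} \<and> x \<in> dom c \<and> \<psi> t x \<in> dom d}
          (\<lambda>(t, y). coord d (\<psi> t (param c y))))"

text \<open>Smooth isotopies starting at the identity and staying in a given set of diffeomorphisms.\<close>

definition isotopy_in ::
  "('a::topological_space, 'e::euclidean_space) chart set \<Rightarrow> ('a \<Rightarrow> 'a) set \<Rightarrow>
     (real \<Rightarrow> 'a \<Rightarrow> 'a) \<Rightarrow> bool" where
  "isotopy_in A G \<psi> \<longleftrightarrow> smooth_family A \<psi> \<and> \<psi> 0 = id \<and> (\<forall>t\<in>{0..1}. \<psi> t \<in> G)"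

definition Cont0 ::
  "('a::topological_space, 'e::euclidean_space) chart set \<Rightarrow>
     ('a \<Rightarrow> ('a, 'e) tvec set) \<Rightarrow> ('a \<Rightarrow> ('a, 'e) tvec set) \<Rightarrow> ('a \<Rightarrow> 'a) set" where
  "Cont0 A \<xi> pos = {\<phi>. \<exists>\<psi>. isotopy_in A (Cont A \<xi> pos) \<psi> \<and> \<psi> 1 = \<phi>}"

text \<open>\<open>Y\<close> is the time-dependent vector field with \<open>d/dt \<psi>\<^sub>t = Y\<^sub>t \<circ> \<psi>\<^sub>t\<close>.\<close>

definition generates ::
  "('a, 'e::euclidean_space) chart set \<Rightarrow> (real \<Rightarrow> 'a \<Rightarrow> ('a, 'e) tvec) \<Rightarrow>
     (real \<Rightarrow> 'a \<Rightarrow> 'a) \<Rightarrow> bool" where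
  "generates A Y \<psi> \<longleftrightarrow> (\<forall>t\<in>{0..1}. \<forall>x. velocity A (\<lambda>s. \<psi> s x) t = Y t (\<psi> t x))"

definition contact_hamiltonian ::
  "('a, 'e) form1 \<Rightarrow> (real \<Rightarrow> 'a \<Rightarrow> ('a, 'e) tvec) \<Rightarrow> real \<Rightarrow> 'a \<Rightarrow> real" where
  "contact_hamiltonian \<alpha> Y t x = \<alpha> x (Y t x)"

section \<open>The norm and the distance\<close>

text \<open>On a closed manifold the supremum of the continuous function \<open>\<bar>H\<^sub>t\<bar>\<close> is its maximum.\<close>

definition contact_norm ::
  "('a::topological_space, 'e::euclidean_space) chart set \<Rightarrow>
     ('a \<Rightarrow> ('a, 'e) tvec set) \<Rightarrow> ('a \<Rightarrow> ('a, 'e) tvec set) \<Rightarrow>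
     ('a, 'e) form1 \<Rightarrow> ('a \<Rightarrow> 'a) \<Rightarrow> real" where
  "contact_norm A \<xi> pos \<alpha> \<phi> =
     Inf {integral {0..1} (\<lambda>t. SUP x. \<bar>contact_hamiltonian \<alpha> Y t x\<bar>) | \<psi> Y.
            isotopy_in A (Cont0 A \<xi> pos) \<psi> \<and> \<psi> 1 = \<phi> \<and> generates A Y \<psi>}"

definition contact_dist ::
  "('a::topological_space, 'e::euclidean_space) chart set \<Rightarrow>
     ('a \<Rightarrow> ('a, 'e) tvec set) \<Rightarrow> ('a \<Rightarrow> ('a, 'e) tvec set) \<Rightarrow>
     ('a, 'e) form1 \<Rightarrow> ('a \<Rightarrow> 'a) \<Rightarrow> ('a \<Rightarrow> 'a) \<Rightarrow> real" where
  "contact_dist A \<xi> pos \<alpha> \<phi> \<psi> = contact_norm A \<xi> pos \<alpha> (\<psi> \<circ> inv \<phi>)"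

definition equivalent_metrics_on :: "'g set \<Rightarrow> ('g \<Rightarrow> 'g \<Rightarrow> real) \<Rightarrow> ('g \<Rightarrow> 'g \<Rightarrow> real) \<Rightarrow> bool" where
  "equivalent_metrics_on G d d' \<longleftrightarrow>
     (\<exists>k>0. \<exists>K>0. \<forall>x\<in>G. \<forall>y\<in>G. k * d x y \<le> d' x y \<and> d' x y \<le> K * d x y)"

end

theory Submission
  imports Defs
begin

text \<open>If \<open>Y\<^sub>t\<close> generates an isotopy, then \<open>\<alpha>'(Y\<^sub>t) = f \<cdot> \<alpha>(Y\<^sub>t)\<close>, so the lengths of one and the same
  isotopy for the two forms differ by a factor between \<open>min f\<close> and \<open>max f\<close>; take infima. The second
  inequality applied to \<open>\<alpha> = f\<^sup>-\<^sup>1 \<cdot> \<alpha>'\<close> gives the first. Analysis enters because \<open>integral\<close>, \<open>SUP\<close> and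
  \<open>Inf\<close> are only meaningful for integrable functions, bounded functions and nonempty sets: the
  Hamiltonian is jointly continuous along the isotopy, hence its supremum is continuous in time by
  compactness, and any \<open>\<psi> \<circ> \<phi>\<^sup>-\<^sup>1\<close> is reached by an isotopy inside the group.\<close>

section \<open>Calculus of smooth maps\<close>

text \<open>Tangent vectors are bare coordinate families and a form is a total function on them, so
  \<open>\<alpha>'\<close> is tied to \<open>\<alpha>\<close> on tangent spaces only, and tangency
  of every generator has to be derived. Smoothness on \<open>[0,1] \<times> N\<close> means local
  extendability, hence one-sided velocities at the ends are computed from a local extension beyond
  the interval. One formula for the velocity, valid at all nearby times and points, yields both
  tangency and joint continuity. \<open>Ck_on\<close> and the smoothness of forms speak of constant
  directions, whereas the chain rule and the Hamiltonian involve varying vectors; expansion in the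
  standard basis bridges this gap in both places. Compactness is also what keeps the infimum of
  \<open>f\<close> away from zero, so that the reciprocal of \<open>f\<close> is bounded.\<close>

lemma Ck_on_cong:
  assumes "open S" "\<And>x. x \<in> S \<Longrightarrow> f x = g x" "Ck_on k S f"
  shows "Ck_on k S g"
  using assms(2,3)
proof (induction k arbitrary: f g)
  case 0
  then show ?case
    by (simp cong: continuous_on_cong)
next
  case (Suc k)
  have d: "f differentiable (at x)" if "x \<in> S" for x
    using Suc.prems that by simp
  have eq: "frechet_derivative f (at x) = frechet_derivative g (at x)" if "x \<in> S" for x
    using d[OF that] \<open>open S\<close> that Suc.prems(1) by (rule frechet_derivative_transform_within_open)
  have "g differentiable (at x)" if "x \<in> S" for x
    using d[OF that] has_derivative_transform_within_open[OF _ \<open>open S\<close> that, of f _ UNIV g] Suc.prems(1)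
    unfolding differentiable_def by blast
  moreover have "Ck_on k S (\<lambda>x. frechet_derivative g (at x) v)" for v
    by (rule Suc.IH[of "\<lambda>x. frechet_derivative f (at x) v"]) (use Suc.prems eq in auto)
  ultimately show ?case
    by simp
qed

text \<open>Derivatives \<open>at x\<close> are unique, so an explicit derivative may replace the
  choice term \<open>frechet_derivative\<close> in the recursion. The calculus rules below rest on
  this.\<close>

lemma Ck_on_SucI:
  assumes "open S" and D: "\<And>x. x \<in> S \<Longrightarrow> (f has_derivative f' x) (at x)"
    and "\<And>v. Ck_on k S (\<lambda>x. f' x v)"
  shows "Ck_on (Suc k) S f"
proof -
  have "f' x = frechet_derivative f (at x)" if "x \<in> S" for x
    using D[OF that] by (rule frechet_derivative_at)
  then have "Ck_on k S (\<lambda>x. frechet_derivative f (at x) v)" for v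
    by (intro Ck_on_cong[OF \<open>open S\<close> _ assms(3)]) simp
  then show ?thesis
    using D by (auto simp: differentiable_def)
qed

lemma Ck_on_Suc_has_derivative:
  "Ck_on (Suc k) S f \<Longrightarrow> x \<in> S \<Longrightarrow> (f has_derivative frechet_derivative f (at x)) (at x)"
  by (simp add: frechet_derivative_works)

lemma Ck_on_imp_continuous_on: "Ck_on k S f \<Longrightarrow> continuous_on S f"
  by (cases k)
    (auto simp: continuous_at_imp_continuous_on differentiable_imp_continuous_within)

lemma Ck_on_SucD: "Ck_on (Suc k) S f \<Longrightarrow> Ck_on k S f"
proof (induction k arbitrary: f)
  case 0
  then show ?case
    using Ck_on_imp_continuous_on Ck_on.simps(1) by blast
next
  case (Suc k)
  then show ?case
    by (metis Ck_on.simps(2))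
qed

lemma Ck_on_subset: "Ck_on k S f \<Longrightarrow> T \<subseteq> S \<Longrightarrow> Ck_on k T f"
  by (induction k arbitrary: f) (auto intro: continuous_on_subset)

lemma Ck_on_const: "open S \<Longrightarrow> Ck_on k S (\<lambda>x. c)"
proof (induction k arbitrary: c)
  case (Suc k)
  show ?case
    by (rule Ck_on_SucI[where f' = "\<lambda>_ _. 0"]) (use Suc in auto)
qed simp

lemma Ck_on_bounded_linear:
  assumes "open S" "bounded_linear h"
  shows "Ck_on k S h"
proof (cases k)
  case 0
  then show ?thesis
    using assms by (simp add: linear_continuous_on)
next
  case (Suc k)
  show ?thesis
    unfolding Suc
    by (rule Ck_on_SucI[OF \<open>open S\<close> bounded_linear_imp_has_derivative[OF \<open>bounded_linear h\<close>]
        Ck_on_const[OF \<open>open S\<close>]])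
qed

text \<open>Kept apart from the general chain rule, which needs a Euclidean space in the middle and
  itself applies the coordinate functionals to the derivative of the inner map.\<close>

lemma Ck_on_linear_compose:
  assumes "open S" "bounded_linear h"
  shows "Ck_on k S f \<Longrightarrow> Ck_on k S (\<lambda>x. h (f x))"
proof (induction k arbitrary: f)
  case 0
  then show ?case
    using assms by (simp add: bounded_linear.continuous_on)
next
  case (Suc k)
  show ?case
    by (rule Ck_on_SucI[OF \<open>open S\<close> bounded_linear.has_derivative[OF \<open>bounded_linear h\<close>]
          Suc.IH[of "\<lambda>x. frechet_derivative f (at x) v" for v]])
      (use Suc.prems in \<open>auto simp: frechet_derivative_works\<close>)
qed

lemma Ck_on_add:
  assumes "open S"
  shows "Ck_on k S f \<Longrightarrow> Ck_on k S g \<Longrightarrow> Ck_on k S (\<lambda>x. f x + g x)"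
proof (induction k arbitrary: f g)
  case 0
  then show ?case
    by (simp add: continuous_on_add)
next
  case (Suc k)
  show ?case
    by (rule Ck_on_SucI[OF \<open>open S\<close> has_derivative_add Suc.IH])
      (use Suc.prems in \<open>auto simp: frechet_derivative_works\<close>)
qed

lemma Ck_on_sum:
  assumes "open S" "\<And>i. i \<in> I \<Longrightarrow> Ck_on k S (f i)"
  shows "Ck_on k S (\<lambda>x. \<Sum>i\<in>I. f i x)"
  using assms(2)
  by (induction I rule: infinite_finite_induct) (auto intro: Ck_on_const Ck_on_add \<open>open S\<close>)

lemma Ck_on_scaleR:
  assumes "open S"
  shows "Ck_on k S f \<Longrightarrow> Ck_on k S g \<Longrightarrow> Ck_on k S (\<lambda>x. f x *\<^sub>R g x)"
proof (induction k arbitrary: f g)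
  case 0
  then show ?case
    by (simp add: continuous_on_scaleR)
next
  case (Suc k)
  have "Ck_on k S f" "Ck_on k S g"
    using Suc.prems by (auto intro: Ck_on_SucD)
  then have "Ck_on k S (\<lambda>x. f x *\<^sub>R frechet_derivative g (at x) v
      + frechet_derivative f (at x) v *\<^sub>R g x)" for v
    using Suc.prems by (intro Ck_on_add[OF \<open>open S\<close>] Suc.IH) auto
  then show ?case
    using Suc.prems
    by (intro Ck_on_SucI[OF \<open>open S\<close> has_derivative_scaleR]) (auto simp: frechet_derivative_works)
qed

lemma Ck_on_Pair:
  assumes "open S" "Ck_on k S f" "Ck_on k S g"
  shows "Ck_on k S (\<lambda>x. (f x, g x))"
proof -
  have "bounded_linear (\<lambda>y. (y, 0))" "bounded_linear (\<lambda>z. (0, z))"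
    by (auto intro: bounded_linear_Pair bounded_linear_ident bounded_linear_zero)
  then have "Ck_on k S (\<lambda>x. (f x, 0) + (0, g x))"
    using assms by (intro Ck_on_add) (auto intro: Ck_on_linear_compose)
  then show ?thesis
    by simp
qed

text \<open>The derivative of the composite evaluates the derivative of \<open>g\<close> in a
  direction that varies with \<open>x\<close>, while the induction hypothesis covers fixed
  directions. Expanding the direction in \<open>Basis\<close> leaves a finite sum of products of
  maps of class \<open>k\<close>; this is why the middle space is Euclidean.\<close>

lemma Ck_on_compose:
  fixes f :: "'e::real_normed_vector \<Rightarrow> 'm::euclidean_space"
  assumes "open S" "open T" "f ` S \<subseteq> T"
  shows "Ck_on k S f \<Longrightarrow> Ck_on k T g \<Longrightarrow> Ck_on k S (\<lambda>x. g (f x))"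
proof (induction k arbitrary: g)
  case 0
  then show ?case
    using continuous_on_compose2 assms(3) by auto
next
  case (Suc k)
  let ?Df = "\<lambda>x. frechet_derivative f (at x)" and ?Dg = "\<lambda>y. frechet_derivative g (at y)"
  have Dg: "(g has_derivative ?Dg (f x)) (at (f x))" if "x \<in> S" for x
    using Suc.prems(2) that assms(3) by (auto simp: frechet_derivative_works)
  have eq: "(\<Sum>b\<in>Basis. (?Df x v \<bullet> b) *\<^sub>R ?Dg (f x) b) = ?Dg (f x) (?Df x v)" if "x \<in> S" for x v
  proof -
    have lin: "linear (?Dg (f x))"
      using Dg[OF that] by (rule has_derivative_linear)
    have "?Dg (f x) (?Df x v) = ?Dg (f x) (\<Sum>b\<in>Basis. (?Df x v \<bullet> b) *\<^sub>R b)"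
      by (simp add: euclidean_representation)
    then show ?thesis
      by (simp add: linear_sum[OF lin] linear_scale[OF lin])
  qed
  have "Ck_on k S (\<lambda>x. \<Sum>b\<in>Basis. (?Df x v \<bullet> b) *\<^sub>R ?Dg (f x) b)" for v
    using Suc.prems Ck_on_SucD[OF Suc.prems(1)]
    by (intro Ck_on_sum[OF \<open>open S\<close>] Ck_on_scaleR[OF \<open>open S\<close>] Suc.IH
        Ck_on_linear_compose[OF \<open>open S\<close> bounded_linear_inner_left]) auto
  then have "Ck_on k S (\<lambda>x. ?Dg (f x) (?Df x v))" for v
    using eq by (rule Ck_on_cong[OF \<open>open S\<close>, rotated])
  moreover have "((\<lambda>x. g (f x)) has_derivative (\<lambda>v. ?Dg (f x) (?Df x v))) (at x)"
    if "x \<in> S" for x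
    using Ck_on_Suc_has_derivative[OF Suc.prems(1) that] Dg[OF that] by (rule has_derivative_compose)
  ultimately show ?case
    by (intro Ck_on_SucI[OF \<open>open S\<close>, where f' = "\<lambda>x v. ?Dg (f x) (?Df x v)"])
qed

section \<open>Smoothness on arbitrary sets through local extensions\<close>

lemma smooth_onE:
  assumes "smooth_on S f" "x \<in> S"
  obtains W g where "open W" "x \<in> W" "\<And>k. Ck_on k W g" "\<And>y. y \<in> S \<Longrightarrow> y \<in> W \<Longrightarrow> g y = f y"
proof -
  from assms have "\<exists>W g. open W \<and> x \<in> W \<and> (\<forall>k. Ck_on k W g) \<and> (\<forall>y\<in>S \<inter> W. g y = f y)"
    unfolding smooth_on_def by (rule bspec)
  then obtain W g where "open W \<and> x \<in> W \<and> (\<forall>k. Ck_on k W g) \<and> (\<forall>y\<in>S \<inter> W. g y = f y)"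
    by (elim exE)
  then show thesis
    by (intro that[of W g]) simp_all
qed

lemma smooth_onI:
  assumes "\<And>x. x \<in> S \<Longrightarrow>
    \<exists>W g. open W \<and> x \<in> W \<and> (\<forall>k. Ck_on k W g) \<and> (\<forall>y\<in>S \<inter> W. g y = f y)"
  shows "smooth_on S f"
  unfolding smooth_on_def using assms by (rule ballI)

lemma smooth_on_subset:
  assumes "smooth_on S f" "T \<subseteq> S"
  shows "smooth_on T f"
proof (rule smooth_onI)
  fix x assume "x \<in> T"
  with assms(2) have "x \<in> S"
    by (rule subsetD)
  with assms(1) obtain W g where "open W" "x \<in> W" "\<And>k. Ck_on k W g"
    "\<And>y. y \<in> S \<Longrightarrow> y \<in> W \<Longrightarrow> g y = f y"
    by (rule smooth_onE) (rule that)
  then show "\<exists>W g. open W \<and> x \<in> W \<and> (\<forall>k. Ck_on k W g) \<and> (\<forall>y\<in>T \<inter> W. g y = f y)"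
    using \<open>T \<subseteq> S\<close> by (intro exI[of _ W] exI[of _ g]) auto
qed

lemma smooth_on_cong:
  assumes "smooth_on S f" "\<And>x. x \<in> S \<Longrightarrow> g x = f x"
  shows "smooth_on S g"
proof (rule smooth_onI)
  fix x assume "x \<in> S"
  with assms(1) obtain W h where "open W" "x \<in> W" "\<And>k. Ck_on k W h"
    "\<And>y. y \<in> S \<Longrightarrow> y \<in> W \<Longrightarrow> h y = f y"
    by (rule smooth_onE) (rule that)
  then show "\<exists>W h. open W \<and> x \<in> W \<and> (\<forall>k. Ck_on k W h) \<and> (\<forall>y\<in>S \<inter> W. h y = g y)"
    using assms(2) by (intro exI[of _ W] exI[of _ h]) simp
qed

lemma smooth_on_local:
  assumes "\<And>x. x \<in> S \<Longrightarrow> \<exists>U. open U \<and> x \<in> U \<and> smooth_on (S \<inter> U) f"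
  shows "smooth_on S f"
proof (rule smooth_onI)
  fix x assume x: "x \<in> S"
  then obtain U where U: "open U" "x \<in> U" "smooth_on (S \<inter> U) f"
    using assms by blast
  have "x \<in> S \<inter> U"
    using x U(2) by simp
  with U(3) obtain W g where W: "open W" "x \<in> W" "\<And>k. Ck_on k W g"
    "\<And>y. y \<in> S \<inter> U \<Longrightarrow> y \<in> W \<Longrightarrow> g y = f y"
    by (rule smooth_onE) (rule that)
  have "Ck_on k (U \<inter> W) g" for k
    using W(3) by (rule Ck_on_subset) simp
  then show "\<exists>W g. open W \<and> x \<in> W \<and> (\<forall>k. Ck_on k W g) \<and> (\<forall>y\<in>S \<inter> W. g y = f y)"
    using U(1,2) W by (intro exI[of _ "U \<inter> W"] exI[of _ g]) (simp add: open_Int)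
qed

lemma smooth_on_Ck_on:
  assumes "\<And>k. Ck_on k UNIV f"
  shows "smooth_on S f"
  by (rule smooth_onI, rule exI[of _ UNIV], rule exI[of _ f]) (simp add: assms)

lemma smooth_on_bounded_linear: "bounded_linear h \<Longrightarrow> smooth_on S h"
  by (rule smooth_on_Ck_on) (rule Ck_on_bounded_linear[OF open_UNIV])

lemma smooth_on_const: "smooth_on S (\<lambda>x. c)"
  by (rule smooth_on_Ck_on) (rule Ck_on_const[OF open_UNIV])

lemma smooth_on_affine: "smooth_on S (\<lambda>s::real. a + s * b)"
  by (rule smooth_on_Ck_on)
    (rule Ck_on_add[OF open_UNIV Ck_on_const[OF open_UNIV]
          Ck_on_bounded_linear[OF open_UNIV bounded_linear_mult_left]])

lemma smooth_on_Pair: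
  assumes "smooth_on S f" "smooth_on S g"
  shows "smooth_on S (\<lambda>x. (f x, g x))"
proof (rule smooth_onI)
  fix x assume x: "x \<in> S"
  with assms(1) obtain V f' where V: "open V" "x \<in> V" "\<And>k. Ck_on k V f'"
    "\<And>y. y \<in> S \<Longrightarrow> y \<in> V \<Longrightarrow> f' y = f y"
    by (rule smooth_onE) (rule that)
  from assms(2) x obtain W g' where W: "open W" "x \<in> W" "\<And>k. Ck_on k W g'"
    "\<And>y. y \<in> S \<Longrightarrow> y \<in> W \<Longrightarrow> g' y = g y"
    by (rule smooth_onE) (rule that)
  have "open (V \<inter> W)"
    using V(1) W(1) by (rule open_Int)
  then have "Ck_on k (V \<inter> W) (\<lambda>y. (f' y, g' y))" for k
    by (rule Ck_on_Pair) (rule Ck_on_subset[OF V(3)] Ck_on_subset[OF W(3)]; simp)+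
  then show "\<exists>W h. open W \<and> x \<in> W \<and> (\<forall>k. Ck_on k W h) \<and> (\<forall>y\<in>S \<inter> W. h y = (f y, g y))"
    using V W \<open>open (V \<inter> W)\<close>
    by (intro exI[of _ "V \<inter> W"] exI[of _ "\<lambda>y. (f' y, g' y)"]) simp
qed

text \<open>The composite of two local extensions extends the composite. Since \<open>T\<close> may
  fail to be open, the extension of \<open>f\<close> can leave \<open>T\<close> away from
  \<open>S\<close>, so its domain is cut down to the preimage of the open set on which
  \<open>g\<close> is extended.\<close>

lemma smooth_on_compose:
  fixes f :: "'e::real_normed_vector \<Rightarrow> 'm::euclidean_space"
  assumes "smooth_on S f" "smooth_on T g" "f ` S \<subseteq> T"
  shows "smooth_on S (\<lambda>x. g (f x))"
proof (rule smooth_onI)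
  fix x assume x: "x \<in> S"
  with assms(1) obtain V f' where V: "open V" "x \<in> V" "\<And>k. Ck_on k V f'"
    "\<And>y. y \<in> S \<Longrightarrow> y \<in> V \<Longrightarrow> f' y = f y"
    by (rule smooth_onE) (rule that)
  have T: "f y \<in> T" if "y \<in> S" for y
    using assms(3) that by blast
  from assms(2) T[OF x] obtain W g' where W: "open W" "f x \<in> W" "\<And>k. Ck_on k W g'"
    "\<And>y. y \<in> T \<Longrightarrow> y \<in> W \<Longrightarrow> g' y = g y"
    by (rule smooth_onE) (rule that)
  let ?U = "V \<inter> f' -` W"
  have "open ?U"
    using V(1) W(1) Ck_on_imp_continuous_on[OF V(3)] by (simp add: continuous_on_open_vimage Int_commute)
  then have "Ck_on k ?U (\<lambda>x. g' (f' x))" for k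
    by (rule Ck_on_compose[OF _ W(1) _ Ck_on_subset[OF V(3)] W(3)]) auto
  moreover have "x \<in> ?U"
    using V(2) V(4)[OF x V(2)] W(2) by simp
  moreover have "g' (f' y) = g (f y)" if "y \<in> S" "y \<in> ?U" for y
    using that V(4)[of y] W(4)[of "f y"] T[of y] by simp
  ultimately show "\<exists>W h. open W \<and> x \<in> W \<and> (\<forall>k. Ck_on k W h) \<and> (\<forall>y\<in>S \<inter> W. h y = g (f y))"
    using \<open>open ?U\<close> by (intro exI[of _ ?U] exI[of _ "\<lambda>x. g' (f' x)"]) simp
qed

lemma smooth_on_imp_continuous_on:
  assumes "smooth_on S f"
  shows "continuous_on S f"
  unfolding continuous_on_def
proof
  fix x assume x: "x \<in> S"
  with assms obtain W g where W: "open W" "x \<in> W" "\<And>k. Ck_on k W g"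
    "\<And>y. y \<in> S \<Longrightarrow> y \<in> W \<Longrightarrow> g y = f y"
    by (rule smooth_onE) (rule that)
  have "continuous_on (S \<inter> W) g"
    using Ck_on_imp_continuous_on[OF W(3)] by (rule continuous_on_subset) simp
  then have "continuous_on (S \<inter> W) f"
    by (rule continuous_on_eq) (simp add: W(4))
  then have "(f \<longlongrightarrow> f x) (at x within S \<inter> W)"
    using x W(2) by (simp add: continuous_on_def)
  moreover have "at x within S = at x within S \<inter> W"
    using W(2,1) by (rule at_within_nhd) auto
  ultimately show "(f \<longlongrightarrow> f x) (at x within S)"
    by simp
qed

lemma smooth_on_open_has_derivative:
  assumes "smooth_on S f" "open S" "x \<in> S"
  shows "(f has_derivative frechet_derivative f (at x)) (at x)"
proof -
  from assms(1,3) obtain W g where W: "open W" "x \<in> W" "\<And>k. Ck_on k W g"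
    "\<And>y. y \<in> S \<Longrightarrow> y \<in> W \<Longrightarrow> g y = f y"
    by (rule smooth_onE) (rule that)
  have "(g has_derivative frechet_derivative g (at x)) (at x)"
    using W(3) W(2) by (rule Ck_on_Suc_has_derivative)
  then have "(f has_derivative frechet_derivative g (at x)) (at x)"
    by (rule has_derivative_transform_within_open[OF _ open_Int[OF assms(2) W(1)]])
      (simp_all add: assms(3) W(2,4))
  then have "f differentiable (at x)"
    unfolding differentiable_def by blast
  then show ?thesis
    unfolding frechet_derivative_works .
qed

section \<open>Gluing over relatively open covers, and suprema over a compact factor\<close>

text \<open>Locality in the form in which it is used: over the closed time interval, preimages of
  chart domains are only relatively open.\<close>

lemma smooth_on_openin_cover:
  assumes "\<And>x. x \<in> S \<Longrightarrow> \<exists>T. openin (top_of_set S) T \<and> x \<in> T \<and> smooth_on T f"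
  shows "smooth_on S f"
proof (rule smooth_on_local)
  fix x assume "x \<in> S"
  then obtain T where T: "openin (top_of_set S) T" "x \<in> T" "smooth_on T f"
    using assms by blast
  then obtain U where "open U" "T = S \<inter> U"
    unfolding openin_open by blast
  then show "\<exists>U. open U \<and> x \<in> U \<and> smooth_on (S \<inter> U) f"
    using T by blast
qed

lemma continuous_on_openin_cover:
  assumes "\<And>x. x \<in> S \<Longrightarrow> \<exists>T. openin (top_of_set S) T \<and> x \<in> T \<and> continuous_on T f"
  shows "continuous_on S f"
  unfolding continuous_on_def
proof
  fix x assume "x \<in> S"
  then obtain T where T: "openin (top_of_set S) T" "x \<in> T" "continuous_on T f"
    using assms by blast
  then obtain U where U: "open U" "T = S \<inter> U"
    unfolding openin_open by blast
  have "at x within S = at x within T"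
    by (rule at_within_nhd[of x U]) (use T U in auto)
  then show "(f \<longlongrightarrow> f x) (at x within S)"
    using T by (simp add: continuous_on_def)
qed

text \<open>Compactness of the second factor makes the continuity in \<open>t\<close> uniform in
  \<open>x\<close>, and a supremum moves by no more than the uniform distance between the
  functions.\<close>

lemma continuous_on_SUP_compact:
  fixes h :: "'t::topological_space \<times> 'a::topological_space \<Rightarrow> real"
  assumes "continuous_on (U \<times> UNIV) h" "compact (UNIV :: 'a set)"
  shows "t \<in> U \<Longrightarrow> bdd_above (range (\<lambda>x. h (t, x)))"
    and "continuous_on U (\<lambda>t. SUP x. h (t, x))"
proof -
  show bdd: "bdd_above (range (\<lambda>x. h (t, x)))" if "t \<in> U" for t
  proof -
    have "continuous_on UNIV (\<lambda>x. h (t, x))"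
      by (rule continuous_on_compose2[OF assms(1)]) (use that in \<open>auto intro!: continuous_intros\<close>)
    then show ?thesis
      using assms(2) by (intro bounded_imp_bdd_above compact_imp_bounded compact_continuous_image)
  qed
  have le: "(SUP x. h (s, x)) \<le> (SUP x. h (t, x)) + e"
    if "s \<in> U" "t \<in> U" "\<And>x. dist (h (s, x)) (h (t, x)) \<le> e" for s t e
  proof (rule cSUP_least)
    fix x
    have "h (s, x) \<le> h (t, x) + e"
      using that(3)[of x] by (simp add: dist_real_def abs_le_iff)
    also have "h (t, x) \<le> (SUP x. h (t, x))"
      by (rule cSUP_upper[OF _ bdd[OF that(2)]]) simp
    finally show "h (s, x) \<le> (SUP x. h (t, x)) + e"
      by simp
  qed simp
  show "continuous_on U (\<lambda>t. SUP x. h (t, x))"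
    unfolding continuous_on_def
  proof (intro ballI tendstoI)
    fix t and e :: real assume t: "t \<in> U" "0 < e"
    \<comment> \<open>Passing to suprema preserves only weak inequalities; \<open>e / 2\<close>
      leaves room for the strict one.\<close>
    obtain X where X: "t \<in> X" "open X" "\<forall>s\<in>X \<inter> U. \<forall>x\<in>UNIV. dist (h (s, x)) (h (t, x)) \<le> e / 2"
      by (rule continuous_on_prod_compactE[OF assms t(1) half_gt_zero[OF t(2)]])
    have "dist (SUP x. h (s, x)) (SUP x. h (t, x)) < e" if "s \<in> X \<inter> U" for s
    proof -
      have "(SUP x. h (s, x)) \<le> (SUP x. h (t, x)) + e / 2" "(SUP x. h (t, x)) \<le> (SUP x. h (s, x)) + e / 2"
        by (rule le; use X(3) that t(1) in \<open>simp add: dist_commute\<close>)+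
      then show ?thesis
        using t(2) by (simp add: dist_real_def abs_less_iff)
    qed
    then show "\<forall>\<^sub>F s in at t within U. dist (SUP x. h (s, x)) (SUP x. h (t, x)) < e"
      using X(1,2) by (auto simp: eventually_at_topological)
  qed
qed

section \<open>Charts and tangent vectors\<close>

locale smooth_manifold =
  fixes A :: "('a::{t2_space,second_countable_topology}, 'e::euclidean_space) chart set"
  assumes atlas: "smooth_atlas A"
begin

lemma atlas_cover: obtains c where "c \<in> A" "x \<in> dom c"
  using atlas unfolding smooth_atlas_def by blast

lemma chart_at: "chart_at A p \<in> A" "p \<in> dom (chart_at A p)"
  using someI_ex[of "\<lambda>c. c \<in> A \<and> p \<in> dom c"] atlas_cover[of p] unfolding chart_at_def by blast+

lemma
  assumes "c \<in> A"
  shows open_dom: "open (dom c)"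
    and open_coord_dom: "open (coord c ` dom c)"
    and homeomorphism_chart: "homeomorphism (dom c) (coord c ` dom c) (coord c) (param c)"
  using assms atlas unfolding smooth_atlas_def by auto

lemma
  assumes "c \<in> A"
  shows param_coord: "x \<in> dom c \<Longrightarrow> param c (coord c x) = x"
    and continuous_on_coord: "continuous_on (dom c) (coord c)"
    and continuous_on_param: "continuous_on (coord c ` dom c) (param c)"
  using homeomorphism_chart[OF assms] unfolding homeomorphism_def by auto

lemma open_coord_image:
  assumes "c \<in> A" "open U" "U \<subseteq> dom c"
  shows "open (coord c ` U)"
  using homeomorphism_imp_open_map[OF homeomorphism_chart[OF assms(1)], of U] assms
    open_coord_dom[OF assms(1)]
  by (auto simp: openin_open_eq open_dom)

section \<open>Chain rule in charts and functoriality of tangent maps\<close>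

text \<open>The transition maps are the local expressions of the identity. Facts about changes of
  chart thereby become instances, with \<open>id\<close>, of facts about smooth maps.\<close>

lemma smooth_map_id: "smooth_map A id"
proof -
  have "{x \<in> dom c. id x \<in> dom d} = dom c \<inter> dom d" for c d :: "('a, 'e) chart"
    by auto
  then show ?thesis
    using atlas unfolding smooth_map_def smooth_atlas_def by (simp add: continuous_on_id)
qed

lemma open_preimage_chart:
  assumes "smooth_map A F" "c \<in> A" "d \<in> A"
  shows "open (coord c ` {x \<in> dom c. F x \<in> dom d})"
proof -
  have "open (F -` dom d)"
    using assms open_dom unfolding smooth_map_def by (auto simp: continuous_on_open_vimage)
  then have "open (dom c \<inter> F -` dom d)"
    using assms open_dom by blast
  then show ?thesis
    using open_coord_image[of c "dom c \<inter> F -` dom d"] assms by (simp add: vimage_def Int_def)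
qed

lemma smooth_map_has_derivative:
  assumes "smooth_map A F" "c \<in> A" "d \<in> A" "p \<in> dom c" "F p \<in> dom d"
  shows "(coord d \<circ> F \<circ> param c has_derivative
    frechet_derivative (coord d \<circ> F \<circ> param c) (at (coord c p))) (at (coord c p))"
  by (rule smooth_on_open_has_derivative[OF _ open_preimage_chart[OF assms(1-3)]])
    (use assms in \<open>auto simp: smooth_map_def\<close>)

lemma frechet_derivative_comp_charts:
  assumes "smooth_map A F" "smooth_map A G" "c \<in> A" "d \<in> A" "e \<in> A"
    and "p \<in> dom c" "G p \<in> dom e" "F (G p) \<in> dom d"
  shows "frechet_derivative (coord d \<circ> (F \<circ> G) \<circ> param c) (at (coord c p)) v =
    frechet_derivative (coord d \<circ> F \<circ> param e) (at (coord e (G p)))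
      (frechet_derivative (coord e \<circ> G \<circ> param c) (at (coord c p)) v)"
proof -
  let ?g = "coord e \<circ> G \<circ> param c" and ?f = "coord d \<circ> F \<circ> param e"
  let ?D = "frechet_derivative ?f (at (coord e (G p))) \<circ> frechet_derivative ?g (at (coord c p))"
  have "(?g has_derivative frechet_derivative ?g (at (coord c p))) (at (coord c p))"
    using assms by (intro smooth_map_has_derivative)
  moreover have "(?f has_derivative frechet_derivative ?f (at (coord e (G p)))) (at (?g (coord c p)))"
    using smooth_map_has_derivative[of F e d "G p"] assms by (simp add: param_coord)
  ultimately have "(?f \<circ> ?g has_derivative ?D) (at (coord c p))"
    by (rule diff_chain_at)
  \<comment> \<open>Inserting the chart \<open>e\<close> changes nothing as long as \<open>G\<close>
    stays in \<open>dom e\<close>, which holds on an open neighbourhood of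
    \<open>coord c p\<close>.\<close>
  then have "(coord d \<circ> (F \<circ> G) \<circ> param c has_derivative ?D) (at (coord c p))"
    by (rule has_derivative_transform_within_open[OF _ open_preimage_chart[of G c e]])
      (use assms in \<open>auto simp: param_coord\<close>)
  from fun_cong[OF frechet_derivative_at[OF this], of v] show ?thesis
    by simp
qed

text \<open>The outer tangent map reads the component at the chart chosen at \<open>G p\<close>,
  which the inner one has just computed. Hence the chain rule through that chart gives the claim for
  arbitrary families \<open>v\<close>.\<close>

lemma tangent_map_comp:
  assumes "smooth_map A F" "smooth_map A G"
  shows "tangent_map A (F \<circ> G) p v = tangent_map A F (G p) (tangent_map A G p v)"
  unfolding tangent_map_def Let_def
  using frechet_derivative_comp_charts[OF assms _ _ chart_at(1) _ chart_at(2)]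
  by (auto simp: chart_at fun_eq_iff)

lemma tangent_spaceD:
  assumes "v \<in> tangent_space A p" "c \<in> A" "p \<in> dom c"
  shows "d \<in> A \<Longrightarrow> p \<in> dom d \<Longrightarrow>
      v d = frechet_derivative (coord d \<circ> param c) (at (coord c p)) (v c)"
    and "\<not> (d \<in> A \<and> p \<in> dom d) \<Longrightarrow> v d = 0"
  using assms unfolding tangent_space_def mem_Collect_eq by blast+

text \<open>Tangency enters here: \<open>tangent_map\<close> sees a single component of
  \<open>v\<close> and rebuilds the others by changes of chart, with zero at charts away from
  \<open>p\<close>.\<close>

lemma tangent_map_id:
  assumes "v \<in> tangent_space A p"
  shows "tangent_map A id p v = v"
proof
  show "tangent_map A id p v d = v d" for d
    using tangent_spaceD[OF assms chart_at, of d] by (simp add: tangent_map_def Let_def)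
qed

lemma coord_vec_in_tangent_space:
  assumes "c \<in> A" "p \<in> dom c"
  shows "coord_vec A c p w \<in> tangent_space A p"
proof -
  have "coord_vec A c p w d =
      frechet_derivative (coord d \<circ> param e) (at (coord e p)) (coord_vec A c p w e)"
    if "e \<in> A" "d \<in> A" "p \<in> dom e \<inter> dom d" for d e
    using frechet_derivative_comp_charts[OF smooth_map_id smooth_map_id assms(1) that(2,1) assms(2)] that
    by (simp add: coord_vec_def)
  moreover have "coord_vec A c p w d = 0" if "d \<notin> A \<or> p \<notin> dom d" for d
    using that by (auto simp: coord_vec_def)
  ultimately show ?thesis
    unfolding tangent_space_def mem_Collect_eq by blast
qed

lemma coord_vec_linear:
  assumes "c \<in> A" "p \<in> dom c"
  shows "coord_vec A c p (a *\<^sub>R v + b *\<^sub>R w) =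
    (\<lambda>d. a *\<^sub>R coord_vec A c p v d + b *\<^sub>R coord_vec A c p w d)"
proof
  fix d
  have "linear (frechet_derivative (coord d \<circ> param c) (at (coord c p)))" if "d \<in> A" "p \<in> dom d"
    using has_derivative_linear[OF smooth_map_has_derivative[OF smooth_map_id assms(1) that(1) assms(2)]] that
    by simp
  then show "coord_vec A c p (a *\<^sub>R v + b *\<^sub>R w) d = a *\<^sub>R coord_vec A c p v d + b *\<^sub>R coord_vec A c p w d"
    by (auto simp: coord_vec_def linear_add linear_scale)
qed

text \<open>Reduces a form on a varying vector to its values on the constant directions
  \<open>b\<close>, the ones for which \<open>smooth_one_form_on\<close> provides
  smoothness.\<close>

lemma one_form_coord_vec:
  assumes "smooth_one_form_on A UNIV \<alpha>" "d \<in> A" "p \<in> dom d"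
  shows "\<alpha> p (coord_vec A d p w) = (\<Sum>b\<in>Basis. (w \<bullet> b) * local_form A \<alpha> d (coord d p) b)"
proof -
  have *: "\<alpha> p (coord_vec A d p (r *\<^sub>R u + s *\<^sub>R v)) =
      r * \<alpha> p (coord_vec A d p u) + s * \<alpha> p (coord_vec A d p v)" for r s u v
    using assms coord_vec_in_tangent_space[OF assms(2,3)]
    by (simp add: coord_vec_linear smooth_one_form_on_def)
  have lin: "linear (\<lambda>w. \<alpha> p (coord_vec A d p w))"
    using *[of 1 _ 1] *[of _ _ 0] by (intro linearI) simp_all
  have "\<alpha> p (coord_vec A d p (\<Sum>b\<in>Basis. (w \<bullet> b) *\<^sub>R b)) =
      (\<Sum>b\<in>Basis. (w \<bullet> b) * \<alpha> p (coord_vec A d p b))"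
    by (simp add: linear_sum[OF lin] linear_scale[OF lin])
  then show ?thesis
    using assms by (simp add: euclidean_representation local_form_def param_coord)
qed

text \<open>Differentiability in one chart suffices: the components in the other charts follow by
  the chain rule for transition maps, since by continuity the curve stays in \<open>dom d\<close>
  for times near \<open>t\<close>.\<close>

lemma velocity_eq_coord_vec:
  assumes "continuous_on {0..1} \<gamma>" "t \<in> {0..1}" "d \<in> A" "\<gamma> t \<in> dom d"
    and "((\<lambda>s. coord d (\<gamma> s)) has_vector_derivative u) (at t within {0..1})"
  shows "velocity A \<gamma> t = coord_vec A d (\<gamma> t) u"
proof
  fix d'
  show "velocity A \<gamma> t d' = coord_vec A d (\<gamma> t) u d'"
  proof (cases "d' \<in> A \<and> \<gamma> t \<in> dom d'")
    case True
    let ?D = "frechet_derivative (coord d' \<circ> param d) (at (coord d (\<gamma> t)))"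
    have "(coord d' \<circ> param d has_derivative ?D) (at (coord d (\<gamma> t)))"
      using smooth_map_has_derivative[OF smooth_map_id assms(3), of d' "\<gamma> t"] True assms(4)
      by simp
    then have comp: "((coord d' \<circ> param d) \<circ> (\<lambda>s. coord d (\<gamma> s)) has_vector_derivative ?D u)
        (at t within {0..1})"
      by (rule vector_derivative_diff_chain_within[OF assms(5) has_derivative_at_withinI])
    have "(\<gamma> \<longlongrightarrow> \<gamma> t) (at t within {0..1})"
      using assms(1,2) by (simp add: continuous_on_def)
    then have "\<forall>\<^sub>F s in at t within {0..1}. \<gamma> s \<in> dom d"
      using open_dom[OF assms(3)] assms(4) by (rule topological_tendstoD)
    then obtain \<delta> where \<delta>: "0 < \<delta>"
      "\<And>s. s \<in> {0..1} \<Longrightarrow> s \<noteq> t \<Longrightarrow> dist s t < \<delta> \<Longrightarrow> \<gamma> s \<in> dom d"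
      unfolding eventually_at by blast
    have "((coord d' \<circ> param d) \<circ> (\<lambda>s. coord d (\<gamma> s))) s = coord d' (\<gamma> s)"
      if "s \<in> {0..1}" "dist s t < \<delta>" for s
      using \<delta>(2)[OF that(1) _ that(2)] assms(3,4) by (cases "s = t") (simp_all add: param_coord)
    from comp this have "((\<lambda>s. coord d' (\<gamma> s)) has_vector_derivative ?D u) (at t within {0..1})"
      by (rule has_vector_derivative_transform_within[OF _ \<delta>(1) assms(2)])
    \<comment> \<open>One-sided derivatives at the end points are unique as well, because the
      interval is nondegenerate.\<close>
    then show ?thesis
      using True assms(2)
      by (simp add: velocity_def coord_vec_def vector_derivative_within_closed_interval)
  qed (auto simp: velocity_def coord_vec_def)
qed

end

section \<open>Smooth families of maps\<close>

definition family_dom ::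
  "('a, 'e) chart \<Rightarrow> ('a, 'e) chart \<Rightarrow> (real \<Rightarrow> 'a \<Rightarrow> 'a) \<Rightarrow> (real \<times> 'e) set" where
  "family_dom c d \<psi> = {(t, coord c x) | t x. t \<in> {0..1} \<and> x \<in> dom c \<and> \<psi> t x \<in> dom d}"

text \<open>Names the local expression inside \<open>smooth_family\<close>, with projections in
  place of a pattern match, so that it can be composed with maps into a product.\<close>

definition family_coord ::
  "('a, 'e) chart \<Rightarrow> ('a, 'e) chart \<Rightarrow> (real \<Rightarrow> 'a \<Rightarrow> 'a) \<Rightarrow> real \<times> 'e \<Rightarrow> 'e" where
  "family_coord c d \<psi> z = coord d (\<psi> (fst z) (param c (snd z)))"

lemma smooth_family_iff:
  "smooth_family A \<psi> \<longleftrightarrow>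
    continuous_on ({0..1} \<times> UNIV) (\<lambda>z. \<psi> (fst z) (snd z)) \<and>
    (\<forall>c\<in>A. \<forall>d\<in>A. smooth_on (family_dom c d \<psi>) (family_coord c d \<psi>))"
  unfolding smooth_family_def family_dom_def[symmetric] family_coord_def[abs_def] case_prod_unfold
  by (rule refl)

text \<open>One affine form covers both the truncation of an isotopy at time \<open>t\<close> and
  its reversal; hence the later spellings \<open>0 + s * t\<close> and
  \<open>1 + t * (-1)\<close>.\<close>

lemma smooth_family_reparam:
  assumes "smooth_family A \<psi>" and r: "\<And>t. t \<in> {0..1} \<Longrightarrow> a + t * b \<in> {0..1}"
  shows "smooth_family A (\<lambda>t. \<psi> (a + t * b))"
  unfolding smooth_family_iff
proof (intro conjI ballI)
  let ?r = "\<lambda>z. (a + fst z * b, snd z)"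
  have cont: "continuous_on ({0..1} \<times> UNIV) (\<lambda>z. \<psi> (fst z) (snd z))"
    using assms(1) unfolding smooth_family_iff by simp
  have "continuous_on ({0..1} \<times> UNIV) ?r"
    by (intro continuous_intros)
  then show "continuous_on ({0..1} \<times> UNIV) (\<lambda>z. \<psi> (a + fst z * b) (snd z))"
    using continuous_on_compose2[OF cont, of "{0..1} \<times> UNIV" ?r] r by (simp add: image_subset_iff)
  fix c d assume cd: "c \<in> A" "d \<in> A"
  let ?S = "family_dom c d (\<lambda>t. \<psi> (a + t * b))"
  have "smooth_on ?S ?r"
    by (rule smooth_on_Pair[OF smooth_on_compose[OF
            smooth_on_bounded_linear[OF bounded_linear_fst] smooth_on_affine subset_UNIV]
          smooth_on_bounded_linear[OF bounded_linear_snd]])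
  moreover have "smooth_on (family_dom c d \<psi>) (family_coord c d \<psi>)"
    using assms(1) cd unfolding smooth_family_iff by simp
  moreover have "?r ` ?S \<subseteq> family_dom c d \<psi>"
    using r unfolding family_dom_def by force
  ultimately have "smooth_on ?S (\<lambda>z. family_coord c d \<psi> (?r z))"
    by (rule smooth_on_compose)
  then show "smooth_on ?S (family_coord c d (\<lambda>t. \<psi> (a + t * b)))"
    by (rule smooth_on_cong) (simp add: family_coord_def)
qed

section \<open>Isotopies inside the group and their generators\<close>

lemma isotopy_inD:
  "isotopy_in A G \<psi> \<Longrightarrow> smooth_family A \<psi>"
  "isotopy_in A G \<psi> \<Longrightarrow> \<psi> 0 = id"
  "isotopy_in A G \<psi> \<Longrightarrow> t \<in> {0..1} \<Longrightarrow> \<psi> t \<in> G"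
  unfolding isotopy_in_def by auto

text \<open>Each stage \<open>\<psi> t\<close> is the end of the truncated isotopy that sends
  \<open>s\<close> to \<open>\<psi> (s * t)\<close>. So an isotopy through contactomorphisms never
  leaves the identity component.\<close>

lemma isotopy_in_Cont0:
  assumes "isotopy_in A (Cont A \<xi> pos) \<psi>"
  shows "isotopy_in A (Cont0 A \<xi> pos) \<psi>"
proof -
  have "\<psi> t \<in> Cont0 A \<xi> pos" if t: "t \<in> {0..1}" for t
  proof -
    have r: "0 + s * t \<in> {0..1}" if "s \<in> {0..1}" for s
      using that t by (simp add: mult_le_one)
    have "isotopy_in A (Cont A \<xi> pos) (\<lambda>s. \<psi> (0 + s * t))"
      using smooth_family_reparam[OF isotopy_inD(1)[OF assms] r]
        isotopy_inD(2,3)[OF assms] r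
      unfolding isotopy_in_def by simp
    then show ?thesis
      unfolding Cont0_def by (auto intro: exI[of _ "\<lambda>s. \<psi> (0 + s * t)"])
  qed
  then show ?thesis
    using assms unfolding isotopy_in_def by simp
qed

lemma Cont_bij: "F \<in> Cont A \<xi> pos \<Longrightarrow> bij F"
  unfolding Cont_def diffeomorphism_def by simp

lemma Cont0_subset_Cont: "Cont0 A \<xi> pos \<subseteq> Cont A \<xi> pos"
  unfolding Cont0_def isotopy_in_def by auto

text \<open>Since every stage is injective, the velocity of the trajectory passing through
  \<open>y\<close> at time \<open>t\<close> is a well-defined vector field, and
  \<open>generates\<close> asks for just this equation. It supplies the lengths over which the norm
  takes an infimum.\<close>

lemma ex_generates:
  assumes "isotopy_in A (Cont0 A \<xi> pos) \<psi>"
  shows "\<exists>Y. generates A Y \<psi>"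
proof
  have "bij (\<psi> t)" if "t \<in> {0..1}" for t
    using isotopy_inD(3)[OF assms that] Cont0_subset_Cont Cont_bij by blast
  then show "generates A (\<lambda>t y. velocity A (\<lambda>s. \<psi> s (inv (\<psi> t) y)) t) \<psi>"
    unfolding generates_def by (simp add: bij_is_inj)
qed

context smooth_manifold
begin

lemma family_dom_iff:
  assumes "c \<in> A"
  shows "z \<in> family_dom c d \<psi> \<longleftrightarrow>
    fst z \<in> {0..1} \<and> snd z \<in> coord c ` dom c \<and> \<psi> (fst z) (param c (snd z)) \<in> dom d"
  unfolding family_dom_def using param_coord[OF assms] by (cases z) auto

text \<open>Around each point a chart \<open>e\<close> for the intermediate value is chosen. Where
  \<open>\<phi>\<close> lands in \<open>dom e\<close>, the composite is the local expression of
  \<open>\<psi>\<close> after the map \<open>?h\<close>, which keeps the time coordinate; these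
  relatively open pieces cover the domain.\<close>

lemma smooth_family_comp:
  assumes "smooth_family A \<psi>" "smooth_family A \<phi>"
  shows "smooth_family A (\<lambda>t. \<psi> t \<circ> \<phi> t)"
  unfolding smooth_family_iff
proof (intro conjI ballI)
  have cont: "continuous_on ({0..1} \<times> UNIV) (\<lambda>z. \<psi> (fst z) (snd z))"
    "continuous_on ({0..1} \<times> UNIV) (\<lambda>z. \<phi> (fst z) (snd z))"
    using assms unfolding smooth_family_iff by auto
  have "continuous_on ({0..1} \<times> UNIV) (\<lambda>z. (fst z, \<phi> (fst z) (snd z)))"
    by (intro continuous_intros cont(2))
  then show "continuous_on ({0..1} \<times> UNIV) (\<lambda>z. (\<psi> (fst z) \<circ> \<phi> (fst z)) (snd z))"
    using continuous_on_compose2[OF cont(1), of "{0..1} \<times> UNIV" "\<lambda>z. (fst z, \<phi> (fst z) (snd z))"]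
    by (simp add: image_subset_iff)
  fix c d assume c: "c \<in> A" and d: "d \<in> A"
  let ?S = "family_dom c d (\<lambda>t. \<psi> t \<circ> \<phi> t)" and ?\<phi> = "\<lambda>z. \<phi> (fst z) (param c (snd z))"
  have S: "fst z \<in> {0..1}" "snd z \<in> coord c ` dom c" "\<psi> (fst z) (?\<phi> z) \<in> dom d"
    if "z \<in> ?S" for z
    using that by (simp_all add: family_dom_iff[OF c])
  have "continuous_on ?S (\<lambda>z. param c (snd z))"
    by (rule continuous_on_compose2[OF continuous_on_param[OF c] continuous_on_snd[OF continuous_on_id]])
      (use S(2) in auto)
  then have "continuous_on ?S (\<lambda>z. (fst z, param c (snd z)))"
    by (intro continuous_intros)
  then have cont_\<phi>: "continuous_on ?S ?\<phi>"
    using continuous_on_compose2[OF cont(2), of ?S "\<lambda>z. (fst z, param c (snd z))"] S(1)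
    by (simp add: image_subset_iff mem_Times_iff del: atLeastAtMost_iff)
  show "smooth_on ?S (family_coord c d (\<lambda>t. \<psi> t \<circ> \<phi> t))"
  proof (rule smooth_on_openin_cover)
    fix z0 assume z0: "z0 \<in> ?S"
    obtain e where e: "e \<in> A" "?\<phi> z0 \<in> dom e"
      by (rule atlas_cover)
    let ?T = "?S \<inter> ?\<phi> -` dom e"
    let ?h = "\<lambda>z. (fst z, family_coord c e \<phi> z)"
    have T: "z \<in> ?S" "?\<phi> z \<in> dom e" if "z \<in> ?T" for z
      using that by simp_all
    have "?T \<subseteq> family_dom c e \<phi>"
      using T(2) S(1,2)[OF T(1)] by (auto simp: family_dom_iff[OF c])
    moreover have "smooth_on (family_dom c e \<phi>) (family_coord c e \<phi>)"
      using assms(2) c e(1) unfolding smooth_family_iff by simp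
    ultimately have "smooth_on ?T (family_coord c e \<phi>)"
      by (rule smooth_on_subset[rotated])
    then have "smooth_on ?T ?h"
      by (rule smooth_on_Pair[OF smooth_on_bounded_linear[OF bounded_linear_fst]])
    moreover have "smooth_on (family_dom e d \<psi>) (family_coord e d \<psi>)"
      using assms(1) d e(1) unfolding smooth_family_iff by simp
    moreover have "?h ` ?T \<subseteq> family_dom e d \<psi>"
    proof
      fix y assume "y \<in> ?h ` ?T"
      then obtain z where z: "z \<in> ?T" "y = ?h z"
        by (rule imageE)
      show "y \<in> family_dom e d \<psi>"
        using T(2)[OF z(1)] S(1,3)[OF T(1)[OF z(1)]]
        by (simp add: z(2) family_dom_iff[OF e(1)] family_coord_def param_coord[OF e(1)]
            del: atLeastAtMost_iff)
    qed
    ultimately have "smooth_on ?T (\<lambda>z. family_coord e d \<psi> (?h z))"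
      by (rule smooth_on_compose)
    then have "smooth_on ?T (family_coord c d (\<lambda>t. \<psi> t \<circ> \<phi> t))"
      by (rule smooth_on_cong) (simp add: family_coord_def param_coord[OF e(1)])
    moreover have "openin (top_of_set ?S) ?T"
      using cont_\<phi> open_dom[OF e(1)] by (rule continuous_openin_preimage_gen)
    moreover have "z0 \<in> ?T"
      using z0 e(2) by simp
    ultimately show "\<exists>T. openin (top_of_set ?S) T \<and> z0 \<in> T \<and>
        smooth_on T (family_coord c d (\<lambda>t. \<psi> t \<circ> \<phi> t))"
      by (intro exI[of _ ?T] conjI)
  qed
qed

text \<open>Lets a fixed map such as the inverse of \<open>\<phi>\<close> be composed with
  isotopies, and turns composition of maps into composition of families evaluated at one
  time.\<close>

lemma smooth_family_const:
  assumes "smooth_map A F"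
  shows "smooth_family A (\<lambda>_. F)"
  unfolding smooth_family_iff
proof (intro conjI ballI)
  have F: "continuous_on UNIV F"
    using assms unfolding smooth_map_def by simp
  show "continuous_on ({0..1} \<times> UNIV) (\<lambda>z. F (snd z))"
    by (rule continuous_on_compose2[OF F continuous_on_snd[OF continuous_on_id]]) simp
  fix c d assume cd: "c \<in> A" "d \<in> A"
  let ?S = "family_dom c d (\<lambda>_. F)" and ?T = "coord c ` {x \<in> dom c. F x \<in> dom d}"
  have "smooth_on ?T (coord d \<circ> F \<circ> param c)"
    using assms cd unfolding smooth_map_def by simp
  moreover have "snd ` ?S \<subseteq> ?T"
    unfolding family_dom_def by auto
  ultimately have "smooth_on ?S (\<lambda>z. (coord d \<circ> F \<circ> param c) (snd z))"
    by (rule smooth_on_compose[OF smooth_on_bounded_linear[OF bounded_linear_snd]])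
  then show "smooth_on ?S (family_coord c d (\<lambda>_. F))"
    by (rule smooth_on_cong) (simp add: family_coord_def)
qed

lemma smooth_family_imp_smooth_map:
  assumes "smooth_family A \<psi>" "t \<in> {0..1}"
  shows "smooth_map A (\<psi> t)"
  unfolding smooth_map_def
proof (intro conjI ballI)
  have cont: "continuous_on ({0..1} \<times> UNIV) (\<lambda>z. \<psi> (fst z) (snd z))"
    using assms unfolding smooth_family_iff by auto
  have "continuous_on UNIV (\<lambda>x. (t, x))"
    by (intro continuous_intros)
  then show "continuous_on UNIV (\<psi> t)"
    using continuous_on_compose2[OF cont, of UNIV "\<lambda>x. (t, x)"] assms(2)
    by (simp add: image_subset_iff)
  fix c d assume cd: "c \<in> A" "d \<in> A"
  let ?S = "coord c ` {x \<in> dom c. \<psi> t x \<in> dom d}"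
  have "smooth_on (family_dom c d \<psi>) (family_coord c d \<psi>)"
    using assms cd unfolding smooth_family_iff by simp
  moreover have "(\<lambda>y. (t, y)) ` ?S \<subseteq> family_dom c d \<psi>"
    using assms(2) unfolding family_dom_def by auto
  ultimately have "smooth_on ?S (\<lambda>y. family_coord c d \<psi> (t, y))"
    by (rule smooth_on_compose[OF smooth_on_Pair[OF smooth_on_const
            smooth_on_bounded_linear[OF bounded_linear_ident]]])
  then show "smooth_on ?S (coord d \<circ> \<psi> t \<circ> param c)"
    by (rule smooth_on_cong) (simp add: family_coord_def)
qed

lemma smooth_map_comp:
  assumes "smooth_map A F" "smooth_map A G"
  shows "smooth_map A (F \<circ> G)"
proof -
  have "smooth_family A (\<lambda>_. F \<circ> G)"
    using smooth_family_const[OF assms(1)] smooth_family_const[OF assms(2)]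
    by (rule smooth_family_comp)
  from smooth_family_imp_smooth_map[OF this, of 0] show ?thesis
    by simp
qed

section \<open>Contactomorphisms\<close>

lemma Cont_comp:
  assumes "F \<in> Cont A \<xi> pos" "G \<in> Cont A \<xi> pos"
  shows "F \<circ> G \<in> Cont A \<xi> pos"
proof -
  have F: "bij F" "smooth_map A F" "smooth_map A (inv F)"
    "\<And>p. tangent_map A F p ` \<xi> p = \<xi> (F p)" "\<And>p. tangent_map A F p ` pos p = pos (F p)"
    using assms(1) unfolding Cont_def diffeomorphism_def by auto
  have G: "bij G" "smooth_map A G" "smooth_map A (inv G)"
    "\<And>p. tangent_map A G p ` \<xi> p = \<xi> (G p)" "\<And>p. tangent_map A G p ` pos p = pos (G p)"
    using assms(2) unfolding Cont_def diffeomorphism_def by auto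
  have "tangent_map A (F \<circ> G) p = tangent_map A F (G p) \<circ> tangent_map A G p" for p
    by (rule ext) (simp add: tangent_map_comp[OF F(2) G(2)])
  then have "tangent_map A (F \<circ> G) p ` \<xi> p = \<xi> (F (G p))"
    "tangent_map A (F \<circ> G) p ` pos p = pos (F (G p))" for p
    by (simp_all only: image_comp[symmetric] F G)
  moreover have "diffeomorphism A (F \<circ> G)"
    unfolding diffeomorphism_def o_inv_distrib[OF F(1) G(1)]
    by (intro conjI bij_comp smooth_map_comp F G)
  ultimately show ?thesis
    unfolding Cont_def by simp
qed

text \<open>Functoriality cancels the tangent map of \<open>F\<close> against that of its inverse,
  but \<open>tangent_map_id\<close> gives this on tangent vectors only; therefore
  \<open>\<xi>\<close> and \<open>pos\<close> are required to consist of such vectors.\<close>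

lemma Cont_inv:
  assumes "F \<in> Cont A \<xi> pos"
    and tangent: "\<And>p. \<xi> p \<subseteq> tangent_space A p" "\<And>p. pos p \<subseteq> tangent_space A p"
  shows "inv F \<in> Cont A \<xi> pos"
proof -
  have F: "bij F" "smooth_map A F" "smooth_map A (inv F)"
    "\<And>p. tangent_map A F p ` \<xi> p = \<xi> (F p)" "\<And>p. tangent_map A F p ` pos p = pos (F p)"
    using assms(1) unfolding Cont_def diffeomorphism_def by auto
  have inv: "inv F \<circ> F = id"
    using F(1) by (simp add: bij_is_inj)
  have id: "tangent_map A (inv F) (F p) (tangent_map A F p v) = v" if "v \<in> tangent_space A p" for p v
    using tangent_map_comp[OF F(3) F(2), of p v] tangent_map_id[OF that] inv by simp
  have image: "tangent_map A (inv F) (F p) ` tangent_map A F p ` V = V"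
    if "V \<subseteq> tangent_space A p" for V p
  proof -
    have "tangent_map A (inv F) (F p) ` tangent_map A F p ` V = (\<lambda>v. v) ` V"
      unfolding image_image by (rule image_cong[OF refl]) (rule id[OF subsetD[OF that]])
    then show ?thesis
      by simp
  qed
  have "tangent_map A (inv F) q ` \<xi> q = \<xi> (inv F q)" "tangent_map A (inv F) q ` pos q = pos (inv F q)" for q
    using image[OF tangent(1)[of "inv F q"]] image[OF tangent(2)[of "inv F q"]] F(1)
    by (simp_all add: F(4,5) bij_inv_eq_iff surj_f_inv_f[OF bij_is_surj[OF F(1)]])
  moreover have "diffeomorphism A (inv F)"
    unfolding diffeomorphism_def inv_inv_eq[OF F(1)]
    by (intro conjI bij_imp_bij_inv F)
  ultimately show ?thesis
    unfolding Cont_def by simp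
qed

text \<open>The isotopy \<open>\<psi>\<^sub>t \<circ> \<phi>\<^sub>1\<^sub>-\<^sub>t \<circ> \<phi>\<^sup>-\<^sup>1\<close> needs neither a smooth concatenation of paths nor the smoothness
  of \<open>t \<mapsto> \<phi>\<^sub>t\<^sup>-\<^sup>1\<close>.\<close>

lemma Cont0_quotient_isotopy:
  assumes "\<phi> \<in> Cont0 A \<xi> pos" "\<psi> \<in> Cont0 A \<xi> pos"
    and tangent: "\<And>p. \<xi> p \<subseteq> tangent_space A p" "\<And>p. pos p \<subseteq> tangent_space A p"
  shows "\<exists>\<Theta>. isotopy_in A (Cont0 A \<xi> pos) \<Theta> \<and> \<Theta> 1 = \<psi> \<circ> inv \<phi>"
proof -
  obtain \<Phi> where \<Phi>: "isotopy_in A (Cont A \<xi> pos) \<Phi>" "\<Phi> 1 = \<phi>"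
    using assms(1) unfolding Cont0_def by auto
  obtain \<Psi> where \<Psi>: "isotopy_in A (Cont A \<xi> pos) \<Psi>" "\<Psi> 1 = \<psi>"
    using assms(2) unfolding Cont0_def by auto
  have \<phi>: "\<phi> \<in> Cont A \<xi> pos"
    using assms(1) Cont0_subset_Cont by blast
  then have inv_\<phi>: "inv \<phi> \<in> Cont A \<xi> pos"
    using tangent by (rule Cont_inv)
  have r: "1 + t * (-1) \<in> {0..1}" if "t \<in> {0..1}" for t :: real
    using that by simp
  let ?\<Theta> = "\<lambda>t. \<Psi> t \<circ> (\<Phi> (1 + t * (-1)) \<circ> inv \<phi>)"
  have "smooth_map A (inv \<phi>)"
    using inv_\<phi> unfolding Cont_def diffeomorphism_def by simp
  then have const: "smooth_family A (\<lambda>_. inv \<phi>)"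
    by (rule smooth_family_const)
  have "smooth_family A (\<lambda>t. \<Phi> (1 + t * (-1)))"
    by (rule smooth_family_reparam[OF isotopy_inD(1)[OF \<Phi>(1)]]) (rule r)
  then have "smooth_family A (\<lambda>t. \<Phi> (1 + t * (-1)) \<circ> inv \<phi>)"
    using const by (rule smooth_family_comp)
  then have "smooth_family A ?\<Theta>"
    by (rule smooth_family_comp[OF isotopy_inD(1)[OF \<Psi>(1)]])
  moreover have "?\<Theta> t \<in> Cont A \<xi> pos" if "t \<in> {0..1}" for t
    by (rule Cont_comp[OF isotopy_inD(3)[OF \<Psi>(1) that]
          Cont_comp[OF isotopy_inD(3)[OF \<Phi>(1) r[OF that]] inv_\<phi>]])
  \<comment> \<open>Reversed time starts the middle factor at \<open>\<phi>\<close> itself, which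
    cancels against \<open>inv \<phi>\<close>.\<close>
  moreover have "?\<Theta> 0 = id"
    using isotopy_inD(2)[OF \<Psi>(1)] \<Phi>(2) bij_is_surj[OF Cont_bij[OF \<phi>]]
    by (simp add: surj_iff)
  ultimately have "isotopy_in A (Cont A \<xi> pos) ?\<Theta>"
    unfolding isotopy_in_def by simp
  moreover have "?\<Theta> 1 = \<psi> \<circ> inv \<phi>"
    using isotopy_inD(2)[OF \<Phi>(1)] \<Psi>(2) by simp
  ultimately show ?thesis
    using isotopy_in_Cont0 by (intro exI[of _ ?\<Theta>] conjI)
qed

section \<open>Contact Hamiltonians\<close>

lemma continuous_on_trajectory:
  assumes "smooth_family A \<psi>"
  shows "continuous_on {0..1} (\<lambda>s. \<psi> s x)"
proof -
  have cont: "continuous_on ({0..1} \<times> UNIV) (\<lambda>z. \<psi> (fst z) (snd z))"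
    using assms unfolding smooth_family_iff by simp
  have "continuous_on {0..1} (\<lambda>s::real. (s, x))"
    by (intro continuous_intros)
  then show ?thesis
    using continuous_on_compose2[OF cont, of "{0..1}" "\<lambda>s. (s, x)"] by (simp add: image_subset_iff)
qed

text \<open>\<open>G\<close> extends the local expression of the family to an open set of times and
  points, and the velocity is its partial derivative in time, the direction \<open>(1, 0)\<close>. A
  single \<open>G\<close> serves all nearby \<open>(t, x)\<close>, and class one makes this
  derivative continuous.\<close>

lemma family_velocity:
  assumes \<psi>: "smooth_family A \<psi>" and c: "c \<in> A" and d: "d \<in> A"
    and "t0 \<in> {0..1}" "x0 \<in> dom c" "\<psi> t0 x0 \<in> dom d"
  obtains W G where "open W" "(t0, coord c x0) \<in> W" "Ck_on (Suc 0) W G"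
    "\<And>t x. t \<in> {0..1} \<Longrightarrow> x \<in> dom c \<Longrightarrow> \<psi> t x \<in> dom d \<Longrightarrow> (t, coord c x) \<in> W \<Longrightarrow>
      velocity A (\<lambda>s. \<psi> s x) t =
        coord_vec A d (\<psi> t x) (frechet_derivative G (at (t, coord c x)) (1, 0))"
proof -
  have dom: "(t, coord c x) \<in> family_dom c d \<psi>" if "t \<in> {0..1}" "x \<in> dom c" "\<psi> t x \<in> dom d" for t x
    using that unfolding family_dom_def by blast
  have "smooth_on (family_dom c d \<psi>) (family_coord c d \<psi>)"
    using \<psi> c d unfolding smooth_family_iff by simp
  from this dom[OF assms(4-6)] obtain W G where W: "open W" "(t0, coord c x0) \<in> W" "\<And>k. Ck_on k W G"
    "\<And>z. z \<in> family_dom c d \<psi> \<Longrightarrow> z \<in> W \<Longrightarrow> G z = family_coord c d \<psi> z"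
    by (rule smooth_onE) (rule that)
  show thesis
  proof (rule that[OF W(1,2) W(3)])
    fix t x assume t: "t \<in> {0..1}" and x: "x \<in> dom c" and \<psi>tx: "\<psi> t x \<in> dom d"
      and tW: "(t, coord c x) \<in> W"
    let ?u = "frechet_derivative G (at (t, coord c x)) (1, 0)" and ?h = "\<lambda>s. (s, coord c x)"
    have "((\<lambda>s. \<psi> s x) \<longlongrightarrow> \<psi> t x) (at t within {0..1})"
      using continuous_on_trajectory[OF \<psi>] t unfolding continuous_on_def by simp
    then have "\<forall>\<^sub>F s in at t within {0..1}. \<psi> s x \<in> dom d"
      using open_dom[OF d] \<psi>tx by (rule topological_tendstoD)
    moreover have "(?h \<longlongrightarrow> ?h t) (at t within {0..1})"
      by (intro tendsto_intros)
    then have "\<forall>\<^sub>F s in at t within {0..1}. ?h s \<in> W"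
      using W(1) tW by (rule topological_tendstoD)
    ultimately have "\<forall>\<^sub>F s in at t within {0..1}. \<psi> s x \<in> dom d \<and> ?h s \<in> W"
      by (rule eventually_conj)
    then obtain \<delta> where \<delta>: "0 < \<delta>"
      "\<And>s. s \<in> {0..1} \<Longrightarrow> s \<noteq> t \<Longrightarrow> dist s t < \<delta> \<Longrightarrow> \<psi> s x \<in> dom d \<and> ?h s \<in> W"
      unfolding eventually_at by blast
    have eq: "(G \<circ> ?h) s = coord d (\<psi> s x)" if s: "s \<in> {0..1}" "dist s t < \<delta>" for s
    proof -
      have "\<psi> s x \<in> dom d \<and> ?h s \<in> W"
        using \<delta>(2)[OF s(1) _ s(2)] \<psi>tx tW by (cases "s = t") simp_all
      then show ?thesis
        using W(4)[OF dom[OF s(1) x]] by (simp add: family_coord_def param_coord[OF c x])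
    qed
    have "(?h has_derivative (\<lambda>r. (r, 0))) (at t within {0..1})"
      by (rule has_derivative_Pair[OF has_derivative_ident has_derivative_const])
    then have "(?h has_vector_derivative (1, 0)) (at t within {0..1})"
      unfolding has_vector_derivative_def by simp
    \<comment> \<open>The full derivative of \<open>G\<close> is restricted to the image of the
      curve, so times \<open>0\<close> and \<open>1\<close> need no separate treatment.\<close>
    moreover have "(G has_derivative frechet_derivative G (at (?h t))) (at (?h t) within ?h ` {0..1})"
      by (rule has_derivative_at_withinI[OF Ck_on_Suc_has_derivative[OF W(3) tW]])
    ultimately have "(G \<circ> ?h has_vector_derivative ?u) (at t within {0..1})"
      by (rule vector_derivative_diff_chain_within)
    then have "((\<lambda>s. coord d (\<psi> s x)) has_vector_derivative ?u) (at t within {0..1})"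
      by (rule has_vector_derivative_transform_within[OF _ \<delta>(1) t]) (rule eq)
    then show "velocity A (\<lambda>s. \<psi> s x) t = coord_vec A d (\<psi> t x) ?u"
      by (rule velocity_eq_coord_vec[OF continuous_on_trajectory[OF \<psi>] t d \<psi>tx])
  qed
qed

lemma velocity_in_tangent_space:
  assumes "smooth_family A \<psi>" "t \<in> {0..1}"
  shows "velocity A (\<lambda>s. \<psi> s x) t \<in> tangent_space A (\<psi> t x)"
proof -
  obtain c where c: "c \<in> A" "x \<in> dom c"
    by (rule atlas_cover)
  obtain d where d: "d \<in> A" "\<psi> t x \<in> dom d"
    by (rule atlas_cover)
  obtain W G where "(t, coord c x) \<in> W"
    "\<And>s y. s \<in> {0..1} \<Longrightarrow> y \<in> dom c \<Longrightarrow> \<psi> s y \<in> dom d \<Longrightarrow> (s, coord c y) \<in> W \<Longrightarrow>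
      velocity A (\<lambda>s. \<psi> s y) s =
        coord_vec A d (\<psi> s y) (frechet_derivative G (at (s, coord c y)) (1, 0))"
    by (rule family_velocity[OF assms(1) c(1) d(1) assms(2) c(2) d(2)]) (rule that)
  then have "velocity A (\<lambda>s. \<psi> s x) t =
      coord_vec A d (\<psi> t x) (frechet_derivative G (at (t, coord c x)) (1, 0))"
    using assms(2) c(2) d(2) by blast
  then show ?thesis
    by (simp add: coord_vec_in_tangent_space[OF d])
qed

text \<open>Locally the expression is a finite sum of products: coordinates of the time derivative
  of \<open>G\<close>, times coefficients of \<open>\<alpha>\<close> along the image point. Each
  factor is continuous.\<close>

lemma continuous_on_form_velocity:
  assumes \<alpha>: "smooth_one_form_on A UNIV \<alpha>" and \<psi>: "smooth_family A \<psi>"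
  shows "continuous_on ({0..1} \<times> UNIV)
    (\<lambda>z. \<alpha> (\<psi> (fst z) (snd z)) (velocity A (\<lambda>s. \<psi> s (snd z)) (fst z)))"
    (is "continuous_on ?S ?H")
proof (rule continuous_on_openin_cover)
  fix z0 :: "real \<times> 'a" assume z0: "z0 \<in> ?S"
  have cont: "continuous_on ?S (\<lambda>z. \<psi> (fst z) (snd z))"
    using \<psi> unfolding smooth_family_iff by simp
  obtain c where c: "c \<in> A" "snd z0 \<in> dom c"
    by (rule atlas_cover)
  obtain d where d: "d \<in> A" "\<psi> (fst z0) (snd z0) \<in> dom d"
    by (rule atlas_cover)
  have t0: "fst z0 \<in> {0..1}"
    using z0 by auto
  obtain W G where W: "open W" "(fst z0, coord c (snd z0)) \<in> W" "Ck_on (Suc 0) W G"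
    and vel: "\<And>t x. t \<in> {0..1} \<Longrightarrow> x \<in> dom c \<Longrightarrow> \<psi> t x \<in> dom d \<Longrightarrow> (t, coord c x) \<in> W \<Longrightarrow>
      velocity A (\<lambda>s. \<psi> s x) t =
        coord_vec A d (\<psi> t x) (frechet_derivative G (at (t, coord c x)) (1, 0))"
    by (rule family_velocity[OF \<psi> c(1) d(1) t0 c(2) d(2)]) (rule that)
  let ?k = "\<lambda>z. (fst z, coord c (snd z))" and ?\<psi> = "\<lambda>z. \<psi> (fst z) (snd z)"
  \<comment> \<open>The neighbourhood is cut out in stages because \<open>?k\<close> is known to be
    continuous only where \<open>coord c\<close> is, on \<open>S1\<close>; its preimage of
    \<open>W\<close> is thus open relative to \<open>S1\<close>.\<close>
  define S1 where "S1 = ?S \<inter> snd -` dom c"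
  define S2 where "S2 = S1 \<inter> ?k -` W"
  define T where "T = S2 \<inter> ?\<psi> -` dom d"
  have sub: "T \<subseteq> S2" "S2 \<subseteq> S1" "S1 \<subseteq> ?S"
    unfolding T_def S2_def S1_def by auto
  have "continuous_on S1 (\<lambda>z. coord c (snd z))"
    by (rule continuous_on_compose2[OF continuous_on_coord[OF c(1)] continuous_on_snd[OF continuous_on_id]])
      (auto simp: S1_def)
  then have k: "continuous_on S1 ?k"
    by (intro continuous_intros)
  have "openin (top_of_set ?S) S1"
    unfolding S1_def
    by (rule continuous_openin_preimage_gen[OF continuous_on_snd[OF continuous_on_id] open_dom[OF c(1)]])
  moreover have "openin (top_of_set S1) S2"
    unfolding S2_def using k W(1) by (rule continuous_openin_preimage_gen)
  moreover have "openin (top_of_set S2) T"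
    unfolding T_def using continuous_on_subset[OF cont subset_trans[OF sub(2,3)]] open_dom[OF d(1)]
    by (rule continuous_openin_preimage_gen)
  ultimately have "openin (top_of_set ?S) T"
    using openin_trans by blast
  moreover have "z0 \<in> T"
    using z0 c(2) d(2) W(2) by (simp add: T_def S2_def S1_def)
  moreover have "continuous_on T ?H"
  proof -
    let ?V = "\<lambda>z. frechet_derivative G (at (?k z)) (1, 0)"
    have k': "continuous_on T ?k"
      using k subset_trans[OF sub(1,2)] by (rule continuous_on_subset)
    have "continuous_on W (\<lambda>y. frechet_derivative G (at y) (1, 0))"
      using W(3) by simp
    then have V: "continuous_on T ?V"
      using k' by (rule continuous_on_compose2) (auto simp: T_def S2_def)
    have coord_\<psi>: "continuous_on T (\<lambda>z. coord d (?\<psi> z))"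
      by (rule continuous_on_compose2[OF continuous_on_coord[OF d(1)]
            continuous_on_subset[OF cont subset_trans[OF sub(1) subset_trans[OF sub(2,3)]]]])
        (auto simp: T_def)
    have "continuous_on (coord d ` dom d) (\<lambda>y. local_form A \<alpha> d y b)" for b
      using \<alpha> d(1) smooth_on_imp_continuous_on unfolding smooth_one_form_on_def by fastforce
    then have form: "continuous_on T (\<lambda>z. local_form A \<alpha> d (coord d (?\<psi> z)) b)" for b
      by (rule continuous_on_compose2[OF _ coord_\<psi>]) (auto simp: T_def)
    have "continuous_on T (\<lambda>z. \<Sum>b\<in>Basis. (?V z \<bullet> b) * local_form A \<alpha> d (coord d (?\<psi> z)) b)"
      by (intro continuous_on_sum continuous_on_mult continuous_on_inner V form continuous_on_const)
    moreover have "(\<Sum>b\<in>Basis. (?V z \<bullet> b) * local_form A \<alpha> d (coord d (?\<psi> z)) b) = ?H z"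
      if "z \<in> T" for z
    proof -
      have z: "fst z \<in> {0..1}" "snd z \<in> dom c" "?\<psi> z \<in> dom d" "?k z \<in> W"
        using that unfolding T_def S2_def S1_def by auto
      show ?thesis
        unfolding vel[OF z] one_form_coord_vec[OF \<alpha> d(1) z(3)] by (rule refl)
    qed
    ultimately show ?thesis
      by (rule continuous_on_eq)
  qed
  ultimately show "\<exists>T. openin (top_of_set ?S) T \<and> z0 \<in> T \<and> continuous_on T ?H"
    by (intro exI[of _ T] conjI)
qed

text \<open>Surjectivity of \<open>\<psi>\<^sub>t\<close> allows to compute the supremum along the isotopy, where joint continuity
  does not require continuity of \<open>(t, y) \<mapsto> \<psi>\<^sub>t\<^sup>-\<^sup>1(y)\<close>.\<close>

lemma
  assumes "compact (UNIV :: 'a set)" and \<alpha>: "smooth_one_form_on A UNIV \<alpha>"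
    and \<psi>: "isotopy_in A (Cont0 A \<xi> pos) \<psi>" and Y: "generates A Y \<psi>"
  shows generator_in_tangent_space: "t \<in> {0..1} \<Longrightarrow> Y t x \<in> tangent_space A x"
    and bdd_above_hamiltonian:
      "t \<in> {0..1} \<Longrightarrow> bdd_above (range (\<lambda>x. \<bar>contact_hamiltonian \<alpha> Y t x\<bar>))"
    and integrable_hamiltonian:
      "(\<lambda>t. SUP x. \<bar>contact_hamiltonian \<alpha> Y t x\<bar>) integrable_on {0..1}"
proof -
  note fam = isotopy_inD(1)[OF \<psi>]
  have surj: "surj (\<psi> t)" if "t \<in> {0..1}" for t
    using isotopy_inD(3)[OF \<psi> that] Cont0_subset_Cont Cont_bij bij_is_surj by blast
  have vel: "velocity A (\<lambda>s. \<psi> s x) t = Y t (\<psi> t x)" if "t \<in> {0..1}" for t x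
    using Y that unfolding generates_def by simp
  show "Y t x \<in> tangent_space A x" if t: "t \<in> {0..1}"
    using velocity_in_tangent_space[OF fam t, of "inv (\<psi> t) x"]
    unfolding vel[OF t] surj_f_inv_f[OF surj[OF t]] .
  let ?H = "\<lambda>z. \<bar>\<alpha> (\<psi> (fst z) (snd z)) (velocity A (\<lambda>s. \<psi> s (snd z)) (fst z))\<bar>"
  have H: "continuous_on ({0..1} \<times> UNIV) ?H"
    by (rule continuous_on_rabs[OF continuous_on_form_velocity[OF \<alpha> fam]])
  have range: "range (\<lambda>x. \<bar>contact_hamiltonian \<alpha> Y t x\<bar>) = range (\<lambda>x. ?H (t, x))" if t: "t \<in> {0..1}" for t
  proof -
    have "range (\<lambda>x. \<bar>contact_hamiltonian \<alpha> Y t x\<bar>) = (\<lambda>x. \<bar>contact_hamiltonian \<alpha> Y t x\<bar>) ` range (\<psi> t)"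
      by (simp add: surj[OF t])
    then show ?thesis
      by (simp add: image_image contact_hamiltonian_def vel[OF t])
  qed
  show "bdd_above (range (\<lambda>x. \<bar>contact_hamiltonian \<alpha> Y t x\<bar>))" if t: "t \<in> {0..1}"
    unfolding range[OF t] using continuous_on_SUP_compact(1)[OF H assms(1) t] .
  have "continuous_on {0..1} (\<lambda>t. SUP x. \<bar>contact_hamiltonian \<alpha> Y t x\<bar>)"
    by (rule continuous_on_eq[OF continuous_on_SUP_compact(2)[OF H assms(1)]])
      (simp only: range)
  then show "(\<lambda>t. SUP x. \<bar>contact_hamiltonian \<alpha> Y t x\<bar>) integrable_on {0..1}"
    by (rule integrable_continuous_interval)
qed

section \<open>Comparison of the norms\<close>

text \<open>\<open>f\<close> and \<open>M\<close> stay general so that the reciprocal function with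
  the bound \<open>inverse m\<close> can be inserted. The isotopy \<open>\<psi>\<close> is a witness
  that both infima range over a nonempty set.\<close>

lemma contact_norm_le_scaled:
  assumes "compact (UNIV :: 'a set)"
    and \<alpha>: "smooth_one_form_on A UNIV \<alpha>" and \<alpha>': "smooth_one_form_on A UNIV \<alpha>'"
    and f: "\<And>p v. v \<in> tangent_space A p \<Longrightarrow> \<alpha>' p v = f p * \<alpha> p v"
    and fM: "\<And>p. \<bar>f p\<bar> \<le> M" and "0 < M"
    and \<psi>: "isotopy_in A (Cont0 A \<xi> pos) \<psi>" "\<psi> 1 = \<phi>"
  shows "contact_norm A \<xi> pos \<alpha>' \<phi> \<le> M * contact_norm A \<xi> pos \<alpha> \<phi>"
proof -
  define len where "len \<beta> Y = integral {0..1} (\<lambda>t. SUP x. \<bar>contact_hamiltonian \<beta> Y t x\<bar>)"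
    for \<beta> and Y :: "real \<Rightarrow> 'a \<Rightarrow> ('a, 'e) tvec"
  \<comment> \<open>The length depends on the generator alone, so both norms become infima over one
    index set, independent of the form.\<close>
  define P where "P = {Y. \<exists>\<psi>. isotopy_in A (Cont0 A \<xi> pos) \<psi> \<and> \<psi> 1 = \<phi> \<and> generates A Y \<psi>}"
  have norm: "contact_norm A \<xi> pos \<beta> \<phi> = (INF Y\<in>P. len \<beta> Y)" for \<beta>
    unfolding contact_norm_def len_def P_def by (rule arg_cong[of _ _ Inf]) auto
  have "P \<noteq> {}"
    using ex_generates[OF \<psi>(1)] \<psi> unfolding P_def by auto
  have sup: "(SUP x. \<bar>contact_hamiltonian \<alpha>' Y t x\<bar>) \<le> M * (SUP x. \<bar>contact_hamiltonian \<alpha> Y t x\<bar>)"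
    if \<chi>: "isotopy_in A (Cont0 A \<xi> pos) \<psi>" "generates A Y \<psi>" and t: "t \<in> {0..1}" for \<psi> Y t
  proof (rule cSUP_least)
    fix x
    have "\<bar>contact_hamiltonian \<alpha>' Y t x\<bar> = \<bar>f x\<bar> * \<bar>contact_hamiltonian \<alpha> Y t x\<bar>"
      unfolding contact_hamiltonian_def
      using f[OF generator_in_tangent_space[OF assms(1) \<alpha> \<chi> t]] by (simp add: abs_mult)
    also have "\<dots> \<le> M * (SUP x. \<bar>contact_hamiltonian \<alpha> Y t x\<bar>)"
      using fM[of x] \<open>0 < M\<close> cSUP_upper[OF UNIV_I bdd_above_hamiltonian[OF assms(1) \<alpha> \<chi> t], of x]
      by (intro mult_mono) simp_all
    finally show "\<bar>contact_hamiltonian \<alpha>' Y t x\<bar> \<le> M * (SUP x. \<bar>contact_hamiltonian \<alpha> Y t x\<bar>)" .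
  qed simp
  have len_le: "len \<alpha>' Y \<le> M * len \<alpha> Y" and len_nonneg: "0 \<le> len \<alpha>' Y" if Y: "Y \<in> P" for Y
  proof -
    obtain \<psi> where \<chi>: "isotopy_in A (Cont0 A \<xi> pos) \<psi>" "generates A Y \<psi>"
      using Y unfolding P_def by blast
    note int = integrable_hamiltonian[OF assms(1) \<alpha> \<chi>] and int' = integrable_hamiltonian[OF assms(1) \<alpha>' \<chi>]
    have "len \<alpha>' Y \<le> integral {0..1} (\<lambda>t. M * (SUP x. \<bar>contact_hamiltonian \<alpha> Y t x\<bar>))"
      unfolding len_def by (rule integral_le[OF int' integrable_on_mult_right[OF int] sup[OF \<chi>]])
    then show "len \<alpha>' Y \<le> M * len \<alpha> Y"
      unfolding len_def by simp
    have "0 \<le> (SUP x. \<bar>contact_hamiltonian \<alpha>' Y t x\<bar>)" if "t \<in> {0..1}" for t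
      by (rule cSUP_upper2[OF bdd_above_hamiltonian[OF assms(1) \<alpha>' \<chi> that] UNIV_I abs_ge_zero])
    then show "0 \<le> len \<alpha>' Y"
      unfolding len_def by (rule integral_nonneg[OF int'])
  qed
  have bdd: "bdd_below (len \<alpha>' ` P)"
    using len_nonneg by (rule bdd_belowI2)
  \<comment> \<open>The factor \<open>M\<close> is moved to the left so that the claim says that a
    number is a lower bound of all lengths for \<open>\<alpha>\<close>.\<close>
  have "(INF Y\<in>P. len \<alpha>' Y) / M \<le> (INF Y\<in>P. len \<alpha> Y)"
  proof (rule cINF_greatest[OF \<open>P \<noteq> {}\<close>])
    fix Y assume Y: "Y \<in> P"
    have "(INF Y\<in>P. len \<alpha>' Y) \<le> M * len \<alpha> Y"
      using cINF_lower[OF bdd Y] len_le[OF Y] by (rule order_trans)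
    then show "(INF Y\<in>P. len \<alpha>' Y) / M \<le> len \<alpha> Y"
      using \<open>0 < M\<close> by (simp add: divide_le_eq mult.commute)
  qed
  then show ?thesis
    unfolding norm using \<open>0 < M\<close> by (simp add: divide_le_eq mult.commute)
qed

lemma smooth_function_imp_continuous_on:
  assumes "smooth_function A f"
  shows "continuous_on UNIV f"
proof (rule continuous_on_openin_cover)
  fix x :: 'a
  obtain c where c: "c \<in> A" "x \<in> dom c"
    by (rule atlas_cover)
  have "smooth_on (coord c ` dom c) (f \<circ> param c)"
    using assms c(1) unfolding smooth_function_def by simp
  then have "continuous_on (dom c) (\<lambda>y. (f \<circ> param c) (coord c y))"
    by (rule continuous_on_compose2[OF smooth_on_imp_continuous_on continuous_on_coord[OF c(1)]]) simp
  then have "continuous_on (dom c) f"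
    by (rule continuous_on_eq) (simp add: param_coord[OF c(1)])
  then show "\<exists>T. openin (top_of_set UNIV) T \<and> x \<in> T \<and> continuous_on T f"
    using open_dom[OF c(1)] c(2) by (intro exI[of _ "dom c"]) simp
qed

end

theorem lemma10:
  fixes A :: "('a::{t2_space,second_countable_topology}, 'e::euclidean_space) chart set"
    and \<xi> pos :: "'a \<Rightarrow> ('a, 'e) tvec set"
    and \<alpha> \<alpha>' :: "('a, 'e) form1"
    and f :: "'a \<Rightarrow> real"
  assumes "smooth_atlas A"
    and "compact (UNIV :: 'a set)"
    and "connected (UNIV :: 'a set)"
    and "cooriented_contact_structure A \<xi> pos"
    and "contact_form_on A \<xi> pos UNIV \<alpha>"
    and "contact_form_on A \<xi> pos UNIV \<alpha>'"
    and "smooth_function A f"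
    and "\<And>p. f p > 0"
    and "\<And>p v. v \<in> tangent_space A p \<Longrightarrow> \<alpha>' p v = f p * \<alpha> p v"
  shows "(\<forall>\<phi>\<in>Cont0 A \<xi> pos. \<forall>\<psi>\<in>Cont0 A \<xi> pos.
            (INF p. f p) * contact_dist A \<xi> pos \<alpha> \<phi> \<psi> \<le> contact_dist A \<xi> pos \<alpha>' \<phi> \<psi> \<and>
            contact_dist A \<xi> pos \<alpha>' \<phi> \<psi> \<le> (SUP p. f p) * contact_dist A \<xi> pos \<alpha> \<phi> \<psi>) \<and>
         equivalent_metrics_on (Cont0 A \<xi> pos)
           (contact_dist A \<xi> pos \<alpha>) (contact_dist A \<xi> pos \<alpha>')"
proof -
  interpret smooth_manifold A
    using assms(1) by unfold_locales
  define m M where "m = (INF p. f p)" and "M = (SUP p. f p)"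
  have comp: "compact (range f)"
    using smooth_function_imp_continuous_on[OF assms(7)] assms(2) by (rule compact_continuous_image)
  then have bdd: "bdd_above (range f)" "bdd_below (range f)"
    by (simp_all add: bounded_imp_bdd_above bounded_imp_bdd_below compact_imp_bounded)
  \<comment> \<open>Pointwise positivity alone would give only \<open>0 \<le> m\<close>; attainment
    on the compact range makes it strict.\<close>
  obtain p where "f p = m"
    using closed_contains_Inf[OF _ bdd(2) compact_imp_closed[OF comp]] unfolding m_def by auto
  then have m: "0 < m"
    using assms(8)[of p] by simp
  have fm: "m \<le> f p" and fM: "f p \<le> M" for p
    unfolding m_def M_def by (rule cINF_lower[OF bdd(2) UNIV_I], rule cSUP_upper[OF UNIV_I bdd(1)])
  have M: "0 < M"
    by (rule less_le_trans[OF m order_trans[OF fm fM]])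
  have forms: "smooth_one_form_on A UNIV \<alpha>" "smooth_one_form_on A UNIV \<alpha>'"
    using assms(5,6) unfolding contact_form_on_def by simp_all
  have tangent: "\<xi> p \<subseteq> tangent_space A p" "pos p \<subseteq> tangent_space A p" for p
    using assms(5) unfolding contact_form_on_def by simp_all
  have f': "\<alpha> p v = inverse (f p) * \<alpha>' p v" if "v \<in> tangent_space A p" for p v
    using assms(9)[OF that] assms(8)[of p] by simp
  have abs_f: "\<bar>f p\<bar> \<le> M" for p
    using fM[of p] assms(8)[of p] by simp
  have abs_f': "\<bar>inverse (f p)\<bar> \<le> inverse m" for p
    using fm[of p] m assms(8)[of p] by (simp add: le_imp_inverse_le)
  have dist: "m * contact_dist A \<xi> pos \<alpha> \<phi> \<psi> \<le> contact_dist A \<xi> pos \<alpha>' \<phi> \<psi> \<and>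
      contact_dist A \<xi> pos \<alpha>' \<phi> \<psi> \<le> M * contact_dist A \<xi> pos \<alpha> \<phi> \<psi>"
    if \<phi>\<psi>: "\<phi> \<in> Cont0 A \<xi> pos" "\<psi> \<in> Cont0 A \<xi> pos" for \<phi> \<psi>
  proof -
    obtain \<Theta> where \<Theta>: "isotopy_in A (Cont0 A \<xi> pos) \<Theta>" "\<Theta> 1 = \<psi> \<circ> inv \<phi>"
      using Cont0_quotient_isotopy[OF \<phi>\<psi> tangent] by blast
    have "contact_dist A \<xi> pos \<alpha> \<phi> \<psi> \<le> inverse m * contact_dist A \<xi> pos \<alpha>' \<phi> \<psi>"
      unfolding contact_dist_def
      by (rule contact_norm_le_scaled[OF assms(2) forms(2,1) f' abs_f' positive_imp_inverse_positive[OF m] \<Theta>])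
    moreover have "contact_dist A \<xi> pos \<alpha>' \<phi> \<psi> \<le> M * contact_dist A \<xi> pos \<alpha> \<phi> \<psi>"
      unfolding contact_dist_def
      by (rule contact_norm_le_scaled[OF assms(2) forms assms(9) abs_f M \<Theta>])
    ultimately show ?thesis
      using m by (simp add: field_simps)
  qed
  then have "equivalent_metrics_on (Cont0 A \<xi> pos)
      (contact_dist A \<xi> pos \<alpha>) (contact_dist A \<xi> pos \<alpha>')"
    unfolding equivalent_metrics_on_def using m M by blast
  with dist show ?thesis
    unfolding m_def M_def by blast
qed

end
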